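(* Suppose a matrix $\mathcal{L}\in\mathbb{R}^{\infty\times n}$ is nonresonant. Then the algebra $\mathcal{Q}_\infty(\mathcal{L})$ of $\mathcal{L}$-quasiperiodic sets has the following properties: (a) $\mathcal{Q}_\infty(\mathcal{L})$ consists of frequency measurable subsets of $\mathbb{Z}^n$; (b) for any $N\in\mathbb{N}$ and any collection of $N$ pairwise nonoverlapping submatrices $\mathcal{L}_1,\ldots,\mathcal{L}_N\in\mathbb{R}^{\infty\times n}$ of $\mathcal{L}$, the corresponding algebras $\mathcal{Q}_\infty(\mathcal{L}_k)$ are mutually independent in the sense that $$\mathbf{F}\Big(\bigcap_{k=1}^N A_k\Big)=\prod_{k=1}^N\mathbf{F}(A_k)$$ for any $A_k\in\mathcal{Q}_\infty(\mathcal{L}_k)$, $1\le k\le N$.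
   Context: $\mathbb{N}=\{1,2,3,\ldots\}$. For $a\in\mathbb{Z}^n$ and $\ell\in\mathbb{N}^n$ let $P_{a,\ell}=\{x\in\mathbb{Z}^n:\ a_k\le x_k<a_k+\ell_k \text{ for all }1\le k\le n\}$, and for $N\in\mathbb{N}$ let $\mathcal{P}_N=\{P_{a,\ell}:\ a\in\mathbb{Z}^n,\ \ell\in\mathbb{N}^n,\ \min_k\ell_k\ge N\}$. For $A\subset\mathbb{Z}^n$ put $\mathbf{F}_*(A)=\sup_{N\ge1}\inf_{P\in\mathcal{P}_N}\frac{\#(A\cap P)}{\#P}$ and $\mathbf{F}^*(A)=\inf_{N\ge1}\sup_{P\in\mathcal{P}_N}\frac{\#(A\cap P)}{\#P}$. The set $A$ is frequency measurable if $\mathbf{F}_*(A)=\mathbf{F}^*(A)$; the common value is the frequency $\mathbf{F}(A)$. $\mathbb{R}^{\infty\times n}$ denotes the real matrices with $n$ columns and countably infinitely many rows (indexed, e.g., by $\mathbb{Z}$). A submatrix of $\mathcal{L}$ is a matrix (with all $n$ columns) formed from rows of $\mathcal{L}$ with distinct indices; submatrices are nonoverlapping if they are formed from disjoint sets of row indices. A finite matrix $\Lambda\in\mathbb{R}^{m\times n}$ is nonresonant if the $n+m$ rows of $\begin{bmatrix}I_n\\ \Lambda\end{bmatrix}$ are linearly independent over the rationals; $\mathcal{L}\in\mathbb{R}^{\infty\times n}$ is nonresonant if, for every $m\in\mathbb{N}$, all its submatrices $\Lambda\in\mathbb{R}^{m\times n}$ are nonresonant. For $G\subset\mathbb{R}^m$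 and $\Lambda\in\mathbb{R}^{m\times n}$ let $Q_m(G,\Lambda)=\{x\in\mathbb{Z}^n:\ \Lambda x\in G+\mathbb{Z}^m\}$ and $\mathcal{Q}_m(\Lambda)=\{Q_m(G,\Lambda):\ G\subset[0,1)^m\text{ is Jordan measurable}\}$. The algebra $\mathcal{Q}_\infty(\mathcal{L})$ is the union of $\mathcal{Q}_m(\Lambda)$ over all $m\in\mathbb{N}$ and all submatrices $\Lambda\in\mathbb{R}^{m\times n}$ of $\mathcal{L}$. A Jordan measurable set is a bounded set whose boundary has zero Lebesgue measure. *)

theory Defs
  imports "HOL-Analysis.Analysis"
begin

section \<open>Frequency of subsets of the integer lattice\<close>

definition box_int :: "int ^ 'n \<Rightarrow> nat ^ 'n \<Rightarrow> (int ^ 'n) set" where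
  "box_int a l = {x. \<forall>k. a $ k \<le> x $ k \<and> x $ k < a $ k + int (l $ k)}"

definition boxes :: "nat \<Rightarrow> (int ^ 'n) set set" where
  "boxes N = {box_int a l | a l. \<forall>k. 1 \<le> l $ k \<and> N \<le> l $ k}"

text \<open>
  For every \<open>N \<ge> 1\<close> the ratios below lie in the unit interval and \<open>boxes N\<close> is nonempty,
  so the suprema and infima of reals are the genuine ones.
\<close>

definition lower_freq :: "(int ^ 'n) set \<Rightarrow> real" where
  "lower_freq A = (SUP N\<in>{1..}. INF P\<in>boxes N. real (card (A \<inter> P)) / real (card P))"

definition upper_freq :: "(int ^ 'n) set \<Rightarrow> real" where
  "upper_freq A = (INF N\<in>{1..}. SUP P\<in>boxes N. real (card (A \<inter> P)) / real (card P))"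

definition freq_measurable :: "(int ^ 'n) set \<Rightarrow> bool" where
  "freq_measurable A \<longleftrightarrow> lower_freq A = upper_freq A"

text \<open>Only meaningful for frequency measurable sets, where both one-sided values agree.\<close>

definition freq :: "(int ^ 'n) set \<Rightarrow> real" where
  "freq A = lower_freq A"


section \<open>Matrices given by their rows\<close>

text \<open>
  A matrix with \<open>n = CARD('n)\<close> columns is the function sending a row index to the row.
  Matrices with infinitely many rows have row index type \<^typ>\<open>int\<close>; a matrix with \<open>m\<close> rows
  is a function on \<^typ>\<open>nat\<close> of which only the values on \<open>{..<m}\<close> matter.

  \<open>submatrix L R I M\<close>: the matrix \<open>M\<close>, with rows indexed by \<open>I\<close>, is formed
  (in some order) from the rows of \<open>L\<close> whose indices form the set \<open>R\<close>, each used once.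
\<close>

definition submatrix ::
  "(int \<Rightarrow> real ^ 'n) \<Rightarrow> int set \<Rightarrow> 'i set \<Rightarrow> ('i \<Rightarrow> real ^ 'n) \<Rightarrow> bool" where
  "submatrix L R I M \<longleftrightarrow> (\<exists>r. bij_betw r I R \<and> (\<forall>i\<in>I. M i = L (r i)))"

definition rat_scale :: "rat \<Rightarrow> real ^ 'n \<Rightarrow> real ^ 'n" where
  "rat_scale q v = of_rat q *\<^sub>R v"

lemma vector_space_rat_scale: "vector_space rat_scale"
  by unfold_locales (simp_all add: rat_scale_def of_rat_add of_rat_mult algebra_simps)

text \<open>The rows of the identity matrix stacked on top of those of \<open>\<Lambda>\<close>.\<close>

definition stacked_row :: "(nat \<Rightarrow> real ^ 'n) \<Rightarrow> 'n + nat \<Rightarrow> real ^ 'n" where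
  "stacked_row \<Lambda> = case_sum (\<lambda>k. row k (mat 1 :: real ^ 'n ^ 'n)) \<Lambda>"

text \<open>
  Independence is that of the family of rows, so repeated rows are excluded by injectivity.
\<close>

definition nonresonant_fin :: "nat \<Rightarrow> (nat \<Rightarrow> real ^ 'n) \<Rightarrow> bool" where
  "nonresonant_fin m \<Lambda> \<longleftrightarrow>
     inj_on (stacked_row \<Lambda>) (UNIV <+> {..<m}) \<and>
     \<not> module.dependent rat_scale (stacked_row \<Lambda> ` (UNIV <+> {..<m}))"

definition nonresonant :: "(int \<Rightarrow> real ^ 'n) \<Rightarrow> bool" where
  "nonresonant L \<longleftrightarrow>
     (\<forall>m\<ge>1. \<forall>R \<Lambda>. submatrix L R {..<m} \<Lambda> \<longrightarrow> nonresonant_fin m \<Lambda>)"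


section \<open>Quasiperiodic sets\<close>

text \<open>
  Since \<open>m\<close> varies, \<open>m\<close>-dimensional real space is represented by
  \<open>{..<m} \<rightarrow>\<^sub>E UNIV\<close>, with the product topology and the (completed) product of
  one-dimensional Lebesgue measures.
\<close>

definition jordan_measurable :: "nat \<Rightarrow> (nat \<Rightarrow> real) set \<Rightarrow> bool" where
  "jordan_measurable m G \<longleftrightarrow>
     G \<subseteq> {..<m} \<rightarrow>\<^sub>E UNIV \<and>
     (\<exists>c. \<forall>g\<in>G. \<forall>i<m. \<bar>g i\<bar> \<le> c) \<and>
     product_topology (\<lambda>_. euclideanreal) {..<m} frontier_of G
       \<in> null_sets (completion (\<Pi>\<^sub>M i\<in>{..<m}. (lborel :: real measure)))"

definition mat_apply :: "nat \<Rightarrow> (nat \<Rightarrow> real ^ 'n) \<Rightarrow> int ^ 'n \<Rightarrow> nat \<Rightarrow> real" where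
  "mat_apply m \<Lambda> x = (\<lambda>i\<in>{..<m}. \<Sum>k\<in>UNIV. \<Lambda> i $ k * of_int (x $ k))"

definition quasiperiodic_set ::
  "nat \<Rightarrow> (nat \<Rightarrow> real) set \<Rightarrow> (nat \<Rightarrow> real ^ 'n) \<Rightarrow> (int ^ 'n) set" where
  "quasiperiodic_set m G \<Lambda> =
     {x. \<exists>g\<in>G. \<exists>z :: nat \<Rightarrow> int. mat_apply m \<Lambda> x = (\<lambda>i\<in>{..<m}. g i + of_int (z i))}"

definition quasiperiodic_fin :: "nat \<Rightarrow> (nat \<Rightarrow> real ^ 'n) \<Rightarrow> (int ^ 'n) set set" where
  "quasiperiodic_fin m \<Lambda> =
     {quasiperiodic_set m G \<Lambda> | G. G \<subseteq> {..<m} \<rightarrow>\<^sub>E {0..<1} \<and> jordan_measurable m G}"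

definition quasiperiodic :: "(int \<Rightarrow> real ^ 'n) \<Rightarrow> (int ^ 'n) set set" where
  "quasiperiodic L =
     \<Union>{quasiperiodic_fin m \<Lambda> | m \<Lambda>. m \<ge> 1 \<and> (\<exists>R. submatrix L R {..<m} \<Lambda>)}"

end

theory Submission
  imports Defs
begin

text \<open>
  Nonresonance says that no nontrivial integer combination of rows of \<open>L\<close> is an integer vector,
  so every nontrivial character of finitely many coordinates \<open>L i \<bullet> x\<close> has averages
  over boxes tending to zero as all side lengths grow. By Stone--Weierstrass on the circle, applied
  to one coordinate at a time, products of continuous functions of these coordinates modulo one
  average to the products of their integrals. Hence each dyadic cell of the torus is visited with
  frequency equal to its volume, and cells in disjoint groups of coordinates are visited
  independently. A Jordan measurable set is squeezed between finite unions of dyadic cells whose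
  volumes differ by an arbitrarily small amount, which carries both facts over to quasiperiodic sets.
\<close>

section \<open>Averages over large boxes\<close>

text \<open>Characters control continuous functions only, whereas indicators of cells jump;
  continuous minorants bridge this gap. Treating one coordinate at a time keeps the approximation on
  the circle, at the price of an induction that must carry along a character in the coordinates not
  yet treated. Independence needs no separate limit argument. The rows used by all the groups are
  pooled into one family indexed by pairs (group, row); disjointness of the row sets keeps this
  family injective, so nonresonance applies to it, and a cell of the pooled torus is a product of
  cells of the groups. The frequency of a quasiperiodic set arises as the common limit of normalized
  counts of inner and outer cells, without being identified as a volume. Lebesgue measure enters
  only through the cells that meet both \<open>G\<close> and its complement. The orders are powers
  of two because such cells are nested, so the unions of these boundary cells decrease to a subset
  of the frontier.\<close>

definition large_boxes :: "(int ^ 'n) set filter" where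
  "large_boxes = (INF N. principal (boxes N))"

definition box_density :: "(int ^ 'n) set \<Rightarrow> (int ^ 'n) set \<Rightarrow> real" where
  "box_density A P = real (card (A \<inter> P)) / real (card P)"

definition box_avg :: "(int ^ 'n \<Rightarrow> complex) \<Rightarrow> (int ^ 'n) set \<Rightarrow> complex" where
  "box_avg f P = (\<Sum>x\<in>P. f x) / of_nat (card P)"

lemma boxes_antimono: "M \<le> N \<Longrightarrow> boxes N \<subseteq> boxes M"
  unfolding boxes_def by (blast intro: le_trans)

lemma eventually_large_boxes: "eventually Q large_boxes \<longleftrightarrow> (\<exists>N. \<forall>P\<in>boxes N. Q P)"
proof -
  have "eventually Q large_boxes \<longleftrightarrow> (\<exists>N\<in>UNIV. eventually Q (principal (boxes N)))"
    unfolding large_boxes_def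
  proof (rule eventually_INF_base)
    fix M N :: nat
    show "\<exists>K\<in>UNIV. principal (boxes K) \<le> inf (principal (boxes M)) (principal (boxes N))"
      by (intro bexI[of _ "max M N"]) (simp_all add: boxes_antimono)
  qed simp
  then show ?thesis
    by (simp add: eventually_principal)
qed

lemma box_int_eq_image:
  "box_int a l = vec_lambda ` (PiE UNIV (\<lambda>k. {a $ k..<a $ k + int (l $ k)}))"
proof
  show "box_int a l \<subseteq> vec_lambda ` (PiE UNIV (\<lambda>k. {a $ k..<a $ k + int (l $ k)}))"
  proof
    fix x assume "x \<in> box_int a l"
    then have "($) x \<in> PiE UNIV (\<lambda>k. {a $ k..<a $ k + int (l $ k)})"
      by (auto simp: box_int_def)
    then show "x \<in> vec_lambda ` (PiE UNIV (\<lambda>k. {a $ k..<a $ k + int (l $ k)}))"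
      by (rule rev_image_eqI) simp
  qed
qed (auto simp: box_int_def)

text \<open>Characters are products of functions of single coordinates, so this factorization
  reduces their sums over a box to one-dimensional geometric sums. With all factors equal to 1 it
  also counts the box.\<close>

lemma sum_box_int_prod:
  fixes g :: "'n::finite \<Rightarrow> int \<Rightarrow> 'a::comm_semiring_1"
  shows "(\<Sum>x\<in>box_int a l. \<Prod>k\<in>UNIV. g k (x $ k))
    = (\<Prod>k\<in>UNIV. \<Sum>t\<in>{a $ k..<a $ k + int (l $ k)}. g k t)"
  unfolding box_int_eq_image
  by (subst sum.reindex)
     (auto simp: inj_on_def vec_lambda_inject prod_sum_PiE)

lemma card_box_int: "card (box_int a l) = (\<Prod>k\<in>UNIV. l $ k)"
  using sum_box_int_prod[where g = "\<lambda>_ _. 1::nat" and a = a and l = l] by simp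

lemma boxes_finite_nonempty:
  assumes "P \<in> boxes N"
  shows "finite P" "P \<noteq> {}" "card P > 0"
proof -
  obtain a l where P: "P = box_int a l" "\<forall>k. 1 \<le> l $ k"
    using assms by (auto simp: boxes_def)
  show "card P > 0"
    using P by (simp add: card_box_int prod_pos Suc_le_eq)
  then show "finite P" "P \<noteq> {}"
    by (auto simp: card_gt_0_iff)
qed

lemma boxes_nonempty: "boxes N \<noteq> {}"
  by (auto simp: boxes_def intro!: exI[of _ "\<chi> k. max 1 N"])

lemma large_boxes_neq_bot [simp]: "large_boxes \<noteq> bot"
  using boxes_nonempty by (auto simp: trivial_limit_def eventually_large_boxes)

lemma eventually_box_finite: "eventually (\<lambda>P. finite P \<and> card P > 0) large_boxes"
  unfolding eventually_large_boxes using boxes_finite_nonempty by blast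

lemma box_density_nonneg: "0 \<le> box_density A P"
  by (simp add: box_density_def)

lemma box_density_le_1: "finite P \<Longrightarrow> box_density A P \<le> 1"
  by (cases "card P = 0") (auto simp: box_density_def divide_le_eq_1 card_mono)

lemma box_density_mono: "finite P \<Longrightarrow> A \<subseteq> B \<Longrightarrow> box_density A P \<le> box_density B P"
  unfolding box_density_def by (intro divide_right_mono) (auto intro: card_mono)

lemma box_density_UN:
  assumes "finite S" "finite P" "disjoint_family_on E S"
  shows "box_density (\<Union>c\<in>S. E c) P = (\<Sum>c\<in>S. box_density (E c) P)"
proof -
  have "(\<Union>c\<in>S. E c) \<inter> P = (\<Union>c\<in>S. E c \<inter> P)"
    by auto
  moreover have "card (\<Union>c\<in>S. E c \<inter> P) = (\<Sum>c\<in>S. card (E c \<inter> P))"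
    using assms by (intro card_UN_disjoint) (auto simp: disjoint_family_on_def)
  ultimately show ?thesis
    by (simp add: box_density_def sum_divide_distrib)
qed

text \<open>Every \<open>boxes N\<close> contains still larger boxes, where the density is close to
  \<open>c\<close>; hence its infimum never exceeds \<open>c\<close> and its supremum never falls
  below \<open>c\<close>, and for large \<open>N\<close> both are within \<open>e\<close> of
  \<open>c\<close>. The bounds valid for every \<open>N\<close> also give the boundedness required
  by the outer supremum and infimum.\<close>

lemma freq_eqI:
  fixes A :: "(int ^ 'n) set"
  assumes "(box_density A \<longlongrightarrow> c) large_boxes"
  shows "freq_measurable A" "freq A = c"
proof -
  have close: "\<exists>N\<ge>1. \<forall>P\<in>boxes N. \<bar>box_density A P - c\<bar> < e" if e: "e > 0" for e
  proof -
    obtain N where "\<forall>P\<in>boxes N. \<bar>box_density A P - c\<bar> < e"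
      using tendstoD[OF assms e] by (auto simp: eventually_large_boxes dist_real_def)
    then show ?thesis
      using boxes_antimono[of N "max 1 N"] by (intro exI[of _ "max 1 N"]) auto
  qed
  have bb: "bdd_below (box_density A ` boxes N)" for N
    using box_density_nonneg by (intro bdd_belowI[of _ 0]) auto
  have ba: "bdd_above (box_density A ` boxes N)" for N
    using box_density_le_1 boxes_finite_nonempty by (intro bdd_aboveI[of _ 1]) blast
  have INF_le: "(INF P\<in>boxes N. box_density A P) \<le> c" for N
  proof (rule field_le_epsilon)
    fix e :: real assume "e > 0"
    then obtain M where M: "\<forall>P\<in>boxes M. \<bar>box_density A P - c\<bar> < e"
      using close by blast
    obtain P :: "(int ^ 'n) set" where P: "P \<in> boxes (max M N)"
      using boxes_nonempty by blast
    then have "P \<in> boxes M" "P \<in> boxes N"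
      using boxes_antimono[of M "max M N"] boxes_antimono[of N "max M N"] by auto
    then show "(INF P\<in>boxes N. box_density A P) \<le> c + e"
      using M cINF_lower[OF bb] by fastforce
  qed
  have SUP_ge: "c \<le> (SUP P\<in>boxes N. box_density A P)" for N
  proof (rule field_le_epsilon)
    fix e :: real assume "e > 0"
    then obtain M where M: "\<forall>P\<in>boxes M. \<bar>box_density A P - c\<bar> < e"
      using close by blast
    obtain P :: "(int ^ 'n) set" where P: "P \<in> boxes (max M N)"
      using boxes_nonempty by blast
    then have "P \<in> boxes M" "P \<in> boxes N"
      using boxes_antimono[of M "max M N"] boxes_antimono[of N "max M N"] by auto
    then show "c \<le> (SUP P\<in>boxes N. box_density A P) + e"
      using M cSUP_upper[OF _ ba] by fastforce
  qed
  have "lower_freq A \<le> c"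
    unfolding lower_freq_def box_density_def[symmetric] by (rule cSUP_least) (use INF_le in auto)
  moreover have "c \<le> lower_freq A"
  proof (rule field_le_epsilon)
    fix e :: real assume "e > 0"
    then obtain N where N: "N \<ge> 1" "\<forall>P\<in>boxes N. \<bar>box_density A P - c\<bar> < e"
      using close by blast
    have "c - e \<le> (INF P\<in>boxes N. box_density A P)"
      using N boxes_nonempty by (intro cINF_greatest) force+
    also have "\<dots> \<le> lower_freq A"
      unfolding lower_freq_def box_density_def[symmetric]
      using INF_le N by (intro cSUP_upper bdd_aboveI[of _ c]) auto
    finally show "c \<le> lower_freq A + e" by simp
  qed
  moreover have "c \<le> upper_freq A"
    unfolding upper_freq_def box_density_def[symmetric] by (rule cINF_greatest) (use SUP_ge in auto)
  moreover have "upper_freq A \<le> c"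
  proof (rule field_le_epsilon)
    fix e :: real assume "e > 0"
    then obtain N where N: "N \<ge> 1" "\<forall>P\<in>boxes N. \<bar>box_density A P - c\<bar> < e"
      using close by blast
    have "upper_freq A \<le> (SUP P\<in>boxes N. box_density A P)"
      unfolding upper_freq_def box_density_def[symmetric]
      using SUP_ge N by (intro cINF_lower bdd_belowI[of _ c]) auto
    also have "\<dots> \<le> c + e"
      using N boxes_nonempty by (intro cSUP_least) force+
    finally show "upper_freq A \<le> c + e" .
  qed
  ultimately show "freq_measurable A" "freq A = c"
    by (auto simp: freq_measurable_def freq_def)
qed

section \<open>Box averages of functions and of characters\<close>

lemma box_avg_add: "box_avg (\<lambda>x. f x + g x) P = box_avg f P + box_avg g P"
  by (simp add: box_avg_def sum.distrib add_divide_distrib)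

lemma box_avg_cmult: "box_avg (\<lambda>x. c * f x) P = c * box_avg f P"
  by (simp add: box_avg_def sum_distrib_left)

lemma norm_box_avg_diff_le:
  assumes "card P > 0" "\<And>x. norm (f x - g x) \<le> e"
  shows "norm (box_avg f P - box_avg g P) \<le> e"
proof -
  have "norm (box_avg f P - box_avg g P) = norm (\<Sum>x\<in>P. f x - g x) / card P"
    by (simp add: box_avg_def sum_subtractf flip: diff_divide_distrib) (simp add: norm_divide)
  also have "\<dots> \<le> (card P * e) / card P"
    by (intro divide_right_mono sum_norm_bound assms) simp
  finally show ?thesis
    using assms by simp
qed

text \<open>Averaging does not increase the sup norm, so a uniform error in \<open>f\<close> causes
  at most the same error in the average over every box. The limits \<open>d\<close> are compared
  with a prescribed \<open>c\<close>, which replaces a Cauchy argument.\<close>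

lemma box_avg_tendsto_uniform_approx:
  assumes "\<And>e. e > 0 \<Longrightarrow> \<exists>g d. (box_avg g \<longlongrightarrow> d) large_boxes \<and>
             (\<forall>x. norm (f x - g x) \<le> e) \<and> norm (c - d) \<le> e"
  shows "(box_avg f \<longlongrightarrow> c) large_boxes"
proof (rule tendstoI)
  fix e :: real assume e: "e > 0"
  obtain g d where g: "(box_avg g \<longlongrightarrow> d) large_boxes"
    "\<forall>x. norm (f x - g x) \<le> e/4" "norm (c - d) \<le> e/4"
    using assms[of "e/4"] e by auto
  have "e/4 > 0" using e by simp
  from tendstoD[OF g(1) this] eventually_box_finite
  show "eventually (\<lambda>P. dist (box_avg f P) c < e) large_boxes"
  proof eventually_elim
    case (elim P)
    have "norm (box_avg f P - box_avg g P) \<le> e/4"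
      using elim g(2) by (intro norm_box_avg_diff_le) auto
    then have "dist (box_avg f P) (box_avg g P) \<le> e/4" "dist c d \<le> e/4"
      using g(3) by (auto simp: dist_norm)
    with elim(1) e dist_triangle[of "box_avg f P" d "box_avg g P"]
      dist_triangle2[of "box_avg f P" c d]
    show ?case by linarith
  qed
qed

text \<open>Multiplied by \<open>1 - cis (2 * pi * \<theta>)\<close>, the geometric sum telescopes
  to a difference of two numbers of modulus 1. The bound depends on neither \<open>a\<close> nor
  \<open>l\<close>, which is what makes the later limit uniform over boxes.\<close>

lemma norm_sum_cis_le:
  assumes "\<theta> \<notin> \<int>"
  shows "norm (\<Sum>t\<in>{a..<a + int l}. cis (2 * pi * (\<theta> * of_int t))) \<le> 2 / norm (1 - cis (2 * pi * \<theta>))"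
proof -
  have "cis (2 * pi * \<theta>) \<noteq> 1"
  proof
    assume "cis (2 * pi * \<theta>) = 1"
    then have "cos (2 * pi * \<theta>) = 1"
      by (metis cis.sel(1) one_complex.sel(1))
    then obtain n :: int where "2 * pi * \<theta> = of_int n * 2 * pi"
      by (auto simp: cos_one_2pi_int)
    then have "\<theta> = of_int n" by simp
    with assms show False by simp
  qed
  moreover have "(1 - cis (2 * pi * \<theta>)) * (\<Sum>t\<in>{a..<a + int l}. cis (2 * pi * (\<theta> * of_int t)))
      = cis (2 * pi * (\<theta> * of_int a)) - cis (2 * pi * (\<theta> * of_int (a + int l)))"
  proof (induction l)
    case (Suc l)
    have "{a..<a + int (Suc l)} = insert (a + int l) {a..<a + int l}"
      by auto
    then show ?case
      using Suc by (simp add: ring_distribs cis_mult add_ac)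
  qed simp
  then have "norm (1 - cis (2 * pi * \<theta>)) * norm (\<Sum>t\<in>{a..<a + int l}. cis (2 * pi * (\<theta> * of_int t))) \<le> 1 + 1"
    by (metis norm_mult norm_cis norm_triangle_ineq4)
  ultimately show ?thesis
    by (simp add: pos_le_divide_eq mult.commute)
qed

lemma cis_sum: "cis (\<Sum>i\<in>I. f i) = (\<Prod>i\<in>I. cis (f i))"
  by (induction I rule: infinite_finite_induct) (simp_all flip: cis_mult)

text \<open>The average factors over the coordinates. If \<open>\<theta> $ k0\<close> is not an
  integer, its factor is a bounded geometric sum divided by a side length of at least
  \<open>N\<close>, and every other factor has modulus at most 1. If all entries are integers, the
  character is 1 on the whole lattice.\<close>

lemma box_avg_character_tendsto:
  fixes \<theta> :: "real ^ 'n"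
  shows "(box_avg (\<lambda>x. cis (2 * pi * (\<Sum>k\<in>UNIV. \<theta> $ k * of_int (x $ k))))
    \<longlongrightarrow> (if \<forall>k. \<theta> $ k \<in> \<int> then 1 else 0)) large_boxes"
proof (cases "\<forall>k. \<theta> $ k \<in> \<int>")
  case True
  have "cis (2 * pi * (\<Sum>k\<in>UNIV. \<theta> $ k * of_int (x $ k))) = 1" for x :: "int ^ 'n"
  proof -
    have "(\<Sum>k\<in>UNIV. \<theta> $ k * of_int (x $ k)) \<in> \<int>"
      using True by (intro Ints_sum Ints_mult) auto
    then show ?thesis
      by (auto elim!: Ints_cases intro: cis_multiple_2pi)
  qed
  then have "eventually (\<lambda>P. box_avg (\<lambda>x. cis (2 * pi * (\<Sum>k\<in>UNIV. \<theta> $ k * of_int (x $ k)))) P = 1) large_boxes"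
    using eventually_box_finite by (auto simp: box_avg_def elim!: eventually_mono)
  with True show ?thesis
    by (auto intro: tendsto_eventually)
next
  case False
  then obtain k0 where k0: "\<theta> $ k0 \<notin> \<int>" by blast
  define f where "f = (\<lambda>x::int^'n. cis (2 * pi * (\<Sum>k\<in>UNIV. \<theta> $ k * of_int (x $ k))))"
  define C where "C = 2 / norm (1 - cis (2 * pi * \<theta> $ k0))"
  have bound: "norm (box_avg f P) \<le> C / real N" if N: "N \<ge> 1" and P: "P \<in> boxes N" for N P
  proof -
    obtain a l where P: "P = box_int a l" and l: "\<forall>k. 1 \<le> l $ k \<and> N \<le> l $ k"
      using P by (auto simp: boxes_def)
    let ?s = "\<lambda>k. \<Sum>t\<in>{a $ k..<a $ k + int (l $ k)}. cis (2 * pi * (\<theta> $ k * of_int t))"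
    have f: "f x = (\<Prod>k\<in>UNIV. cis (2 * pi * (\<theta> $ k * of_int (x $ k))))" for x
      by (simp add: f_def sum_distrib_left flip: cis_sum)
    have "(\<Sum>x\<in>P. f x) = (\<Prod>k\<in>UNIV. ?s k)"
      unfolding P f by (rule sum_box_int_prod)
    then have "norm (box_avg f P) = (\<Prod>k\<in>UNIV. norm (?s k) / real (l $ k))"
      by (simp add: box_avg_def P card_box_int norm_divide prod_dividef flip: prod_norm)
    also have "\<dots> = norm (?s k0) / real (l $ k0) * (\<Prod>k\<in>UNIV - {k0}. norm (?s k) / real (l $ k))"
      by (simp add: prod.remove)
    also have "\<dots> \<le> norm (?s k0) / real (l $ k0) * 1"
    proof (intro mult_left_mono prod_le_1 conjI)
      fix k
      have "norm (?s k) \<le> real (card {a $ k..<a $ k + int (l $ k)}) * 1"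
        by (rule sum_norm_bound) simp
      then show "norm (?s k) / real (l $ k) \<le> 1"
        by (cases "l $ k = 0") (auto simp: divide_le_eq_1)
    qed auto
    also have "\<dots> \<le> C / real N"
      unfolding mult_1_right
      using norm_sum_cis_le[OF k0] l N by (intro frac_le) (auto simp: C_def)
    finally show ?thesis .
  qed
  have "(box_avg f \<longlongrightarrow> 0) large_boxes"
  proof (rule tendstoI)
    fix e :: real assume e: "e > 0"
    obtain N :: nat where N: "C / e < real N"
      using reals_Archimedean2 by blast
    \<comment> \<open>\<open>bound\<close> needs a positive side length, hence
      \<open>Suc N\<close>.\<close>
    have "C / real (Suc N) < e"
    proof -
      have "C / e < real (Suc N)" using N by simp
      then show ?thesis using e by (simp add: field_simps)
    qed
    then show "eventually (\<lambda>P. dist (box_avg f P) 0 < e) large_boxes"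
      unfolding eventually_large_boxes using bound[of "Suc N"] by (intro exI[of _ "Suc N"]) fastforce
  qed
  with k0 show ?thesis
    unfolding f_def by auto
qed

section \<open>Equidistribution modulo one\<close>

text \<open>Products are not among the generating rules, so that inductions over this set have just
  two cases; closure under products is derived. The parameter has period 1 to match coordinates
  modulo one.\<close>

inductive_set trig_polys :: "(real \<Rightarrow> complex) set" where
  monomial: "(\<lambda>t. a * cis (2 * pi * (of_int k * t))) \<in> trig_polys"
| add: "p \<in> trig_polys \<Longrightarrow> q \<in> trig_polys \<Longrightarrow> (\<lambda>t. p t + q t) \<in> trig_polys"

lemma trig_polys_mult:
  assumes "p \<in> trig_polys" "q \<in> trig_polys"
  shows "(\<lambda>t. p t * q t) \<in> trig_polys"
  using assms(1)
proof induction
  case (monomial a k)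
  from assms(2) show ?case
  proof induction
    case (monomial b l)
    have "(\<lambda>t. a * cis (2 * pi * (of_int k * t)) * (b * cis (2 * pi * (of_int l * t))))
        = (\<lambda>t. (a * b) * cis (2 * pi * (of_int (k + l) * t)))"
      by (simp add: ring_distribs mult_ac flip: cis_mult)
    then show ?case
      using trig_polys.monomial by metis
  next
    case (add p q)
    then show ?case
      using trig_polys.add by (simp add: ring_distribs)
  qed
next
  case (add p q)
  then show ?case
    using trig_polys.add by (simp add: ring_distribs)
qed

lemma has_integral_character:
  "((\<lambda>t. cis (2 * pi * (of_int k * t))) has_integral (if k = 0 then 1 else 0)) {0..1}"
proof (cases "k = 0")
  case True
  then show ?thesis
    using has_integral_const_real[of "1::complex" 0 1] by simp
next
  case False
  define w where "w = 2 * complex_of_real pi * \<i> * of_int k"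
  have w: "w \<noteq> 0" using False by (simp add: w_def)
  have cis: "cis (2 * pi * (of_int k * t)) = exp (w * of_real t)" for t
    by (simp add: cis_conv_exp w_def mult_ac)
  have "((\<lambda>t. exp (w * of_real t)) has_integral exp (w * of_real 1) / w - exp (w * of_real 0) / w) {0..1}"
  proof (intro fundamental_theorem_of_calculus)
    fix t :: real
    have "((\<lambda>z. exp (w * z) / w) has_field_derivative exp (w * of_real t)) (at (of_real t))"
      using w by (auto intro!: derivative_eq_intros)
    then show "((\<lambda>t. exp (w * of_real t) / w) has_vector_derivative exp (w * of_real t)) (at t within {0..1})"
      by (rule has_vector_derivative_real_field)
  qed simp
  moreover have "exp (w * of_real 1) = 1"
    unfolding cis[symmetric] by simp
  ultimately show ?thesis
    using False by (simp add: cis)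
qed

lemma trig_polys_integrable: "p \<in> trig_polys \<Longrightarrow> p integrable_on {0..1}"
proof (induction rule: trig_polys.induct)
  case (monomial a k)
  then show ?case
    using has_integral_mult_right[OF has_integral_character] by blast
qed (rule integrable_add)

text \<open>Stone-Weierstrass is applied to the continuous real functions on the circle whose
  pullback to the parameter \<open>t\<close> is in \<open>trig_polys\<close>. They form an algebra
  by \<open>trig_polys_mult\<close>, and \<open>Re\<close> and \<open>Im\<close>, which combine the
  characters of index 1 and -1, separate points.\<close>

lemma trig_polys_dense:
  fixes h :: "complex \<Rightarrow> real"
  assumes "continuous_on (sphere 0 1) h" "e > 0"
  shows "\<exists>p\<in>trig_polys. \<forall>t. norm (of_real (h (cis (2 * pi * t))) - p t) \<le> e"
proof -
  let ?T = "\<lambda>f. (\<lambda>t. complex_of_real (f (cis (2 * pi * t)))) \<in> trig_polys"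
  have "\<exists>g. (?T g \<and> continuous_on (sphere 0 1) g) \<and> (\<forall>z\<in>sphere 0 1. \<bar>h z - g z\<bar> < e)"
  proof (rule Stone_Weierstrass_HOL)
    show "?T (\<lambda>_. c) \<and> continuous_on (sphere 0 1) (\<lambda>_::complex. c)" for c
      using trig_polys.monomial[of "of_real c" 0] by simp
    show "?T (\<lambda>x. f x + g x) \<and> continuous_on (sphere 0 1) (\<lambda>x. f x + g x)"
      if "(?T f \<and> continuous_on (sphere 0 1) f) \<and> ?T g \<and> continuous_on (sphere 0 1) g" for f g
      using that by (auto intro: trig_polys.add continuous_on_add)
    show "?T (\<lambda>x. f x * g x) \<and> continuous_on (sphere 0 1) (\<lambda>x. f x * g x)"
      if "(?T f \<and> continuous_on (sphere 0 1) f) \<and> ?T g \<and> continuous_on (sphere 0 1) g" for f g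
      using that by (auto intro: trig_polys_mult continuous_on_mult)
    have Re: "?T Re"
    proof -
      have "(\<lambda>t. complex_of_real (Re (cis (2 * pi * t)))) =
        (\<lambda>t. 1/2 * cis (2 * pi * (of_int 1 * t)) + 1/2 * cis (2 * pi * (of_int (-1) * t)))"
        by (auto simp: complex_eq_iff)
      then show ?thesis
        using trig_polys.add[OF trig_polys.monomial trig_polys.monomial] by metis
    qed
    have Im: "?T Im"
    proof -
      have "(\<lambda>t. complex_of_real (Im (cis (2 * pi * t)))) =
        (\<lambda>t. -\<i>/2 * cis (2 * pi * (of_int 1 * t)) + \<i>/2 * cis (2 * pi * (of_int (-1) * t)))"
        by (auto simp: complex_eq_iff)
      then show ?thesis
        using trig_polys.add[OF trig_polys.monomial trig_polys.monomial] by metis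
    qed
    show "\<exists>f. (?T f \<and> continuous_on (sphere 0 1) f) \<and> f x \<noteq> f y"
      if xy: "x \<in> sphere 0 1 \<and> y \<in> sphere 0 1 \<and> x \<noteq> y" for x y
    proof (cases "Re x = Re y")
      case True
      then have "Im x \<noteq> Im y" using xy by (simp add: complex_eq_iff)
      then show ?thesis
        using Im by (intro exI[of _ Im]) (auto intro: continuous_intros)
    next
      case False
      then show ?thesis
        using Re by (intro exI[of _ Re]) (auto intro: continuous_intros)
    qed
  qed (use assms in auto)
  then obtain g where g: "?T g" "\<forall>z\<in>sphere 0 1. \<bar>h z - g z\<bar> < e"
    by blast
  have "norm (complex_of_real (h (cis (2 * pi * t))) - of_real (g (cis (2 * pi * t)))) \<le> e" for t
    using g(2)[rule_format, of "cis (2 * pi * t)"]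
    unfolding of_real_diff[symmetric] norm_of_real by simp
  then show ?thesis
    using g(1) by (intro bexI[OF _ g(1)]) blast
qed

text \<open>The hypothesis \<open>u\<close> says that the weight has mean \<open>c\<close> and is
  asymptotically uncorrelated with every nontrivial character of \<open>y\<close>. By linearity only
  the constant term of \<open>p\<close> survives, and that term is its integral.\<close>

lemma box_avg_trig_poly:
  assumes p: "p \<in> trig_polys"
    and u: "\<And>k::int. (box_avg (\<lambda>x. u x * cis (2 * pi * (of_int k * y x))) \<longlongrightarrow> (if k = 0 then c else 0)) large_boxes"
  shows "(box_avg (\<lambda>x. u x * p (y x)) \<longlongrightarrow> c * integral {0..1} p) large_boxes"
  using p
proof induction
  case (monomial a k)
  have 1: "integral {0..1} (\<lambda>t. a * cis (2 * pi * (of_int k * t))) = a * (if k = 0 then 1 else 0)"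
    by (rule integral_unique[OF has_integral_mult_right[OF has_integral_character]])
  have 2: "box_avg (\<lambda>x. u x * (a * cis (2 * pi * (of_int k * y x))))
      = (\<lambda>P. a * box_avg (\<lambda>x. u x * cis (2 * pi * (of_int k * y x))) P)"
    unfolding box_avg_cmult[symmetric] by (simp add: mult_ac)
  have 3: "a * (if k = 0 then c else 0) = c * (a * (if k = 0 then 1 else 0))"
    by simp
  show ?case
    unfolding 1 2 3[symmetric] by (intro tendsto_mult_left u)
next
  case (add p q)
  have "box_avg (\<lambda>x. u x * (p (y x) + q (y x)))
      = (\<lambda>P. box_avg (\<lambda>x. u x * p (y x)) P + box_avg (\<lambda>x. u x * q (y x)) P)"
    unfolding box_avg_add[symmetric] by (simp add: ring_distribs)
  moreover have "integral {0..1} (\<lambda>t. p t + q t) = integral {0..1} p + integral {0..1} q"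
    by (intro integral_add trig_polys_integrable add.hyps)
  ultimately show ?case
    using tendsto_add[OF add.IH] by (simp add: ring_distribs)
qed

lemma box_avg_circle_function:
  fixes h :: "complex \<Rightarrow> real"
  assumes u: "\<And>k::int. (box_avg (\<lambda>x. u x * cis (2 * pi * (of_int k * y x))) \<longlongrightarrow> (if k = 0 then c else 0)) large_boxes"
    and u1: "\<And>x. norm (u x) \<le> 1"
    and h: "continuous_on (sphere 0 1) h"
  shows "(box_avg (\<lambda>x. u x * of_real (h (cis (2 * pi * y x))))
    \<longlongrightarrow> c * of_real (integral {0..1} (\<lambda>t. h (cis (2 * pi * t))))) large_boxes"
proof (rule box_avg_tendsto_uniform_approx)
  fix e :: real assume e: "e > 0"
  \<comment> \<open>An error in \<open>h\<close> is weighted by at most 1 in the averages and by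
    \<open>norm c\<close> in the limit; this \<open>d\<close> serves both, and the summand 1 keeps
    the denominator positive.\<close>
  define d where "d = e / (1 + norm c)"
  have c: "1 + norm c > 0" by (simp add: add_pos_nonneg)
  then have d: "d > 0" "d \<le> e" "norm c * d \<le> e"
    using e by (auto simp: d_def divide_simps algebra_simps)
  obtain p where p: "p \<in> trig_polys" "\<And>t. norm (of_real (h (cis (2 * pi * t))) - p t) \<le> d"
    using trig_polys_dense[OF h d(1)] by blast
  have "continuous_on {0..1} (\<lambda>t. h (cis (2 * pi * t)))"
    by (rule continuous_on_compose2[OF h]) (auto intro!: continuous_intros)
  then have "((\<lambda>t. h (cis (2 * pi * t))) has_integral integral {0..1} (\<lambda>t. h (cis (2 * pi * t)))) {0..1}"
    by (intro integrable_integral integrable_continuous_real)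
  from has_integral_linear[OF this bounded_linear_of_real]
  have "((\<lambda>t. complex_of_real (h (cis (2 * pi * t)))) has_integral
      of_real (integral {0..1} (\<lambda>t. h (cis (2 * pi * t))))) (cbox 0 1)"
    by (simp add: o_def)
  from has_integral_diff[OF this, of p "integral {0..1} p"]
  have "((\<lambda>t. of_real (h (cis (2 * pi * t))) - p t) has_integral
      of_real (integral {0..1} (\<lambda>t. h (cis (2 * pi * t)))) - integral {0..1} p) (cbox 0 1)"
    using trig_polys_integrable[OF p(1)] by (simp add: integrable_integral)
  from has_integral_bound[OF _ this, of d] p(2) d(1)
  have le: "norm (of_real (integral {0..1} (\<lambda>t. h (cis (2 * pi * t)))) - integral {0..1} p) \<le> d"
    by simp
  show "\<exists>g b. (box_avg g \<longlongrightarrow> b) large_boxes \<and>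
      (\<forall>x. norm (u x * of_real (h (cis (2 * pi * y x))) - g x) \<le> e) \<and>
      norm (c * of_real (integral {0..1} (\<lambda>t. h (cis (2 * pi * t)))) - b) \<le> e"
  proof (intro exI conjI allI)
    show "(box_avg (\<lambda>x. u x * p (y x)) \<longlongrightarrow> c * integral {0..1} p) large_boxes"
      by (rule box_avg_trig_poly[OF p(1) u])
    show "norm (u x * of_real (h (cis (2 * pi * y x))) - u x * p (y x)) \<le> e" for x
    proof -
      have "norm (u x) * norm (of_real (h (cis (2 * pi * y x))) - p (y x)) \<le> 1 * d"
        using u1 p(2) by (intro mult_mono) auto
      then show ?thesis
        using d(2) by (simp add: norm_mult flip: right_diff_distrib)
    qed
    have "norm c * norm (of_real (integral {0..1} (\<lambda>t. h (cis (2 * pi * t)))) - integral {0..1} p) \<le> norm c * d"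
      using le by (intro mult_left_mono) auto
    then show "norm (c * of_real (integral {0..1} (\<lambda>t. h (cis (2 * pi * t)))) - c * integral {0..1} p) \<le> e"
      using d(3) by (simp add: norm_mult flip: right_diff_distrib)
  qed
qed

section \<open>Joint equidistribution of independent coordinates\<close>

definition int_dot :: "real ^ 'n \<Rightarrow> int ^ 'n \<Rightarrow> real" where
  "int_dot w x = (\<Sum>k\<in>UNIV. w $ k * of_int (x $ k))"

text \<open>Nonresonance with denominators cleared; the identity rows are absorbed into membership
  in \<open>\<int>\<close>. The index type is arbitrary so that the rows of several submatrices can
  be pooled under pairs. As a condition on a family it also rules out repeated rows, through the
  coefficients 1 and -1.\<close>

definition int_independent :: "'i set \<Rightarrow> ('i \<Rightarrow> real ^ 'n) \<Rightarrow> bool" where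
  "int_independent I v \<longleftrightarrow>
     (\<forall>q :: 'i \<Rightarrow> int. (\<forall>k. (\<Sum>i\<in>I. of_int (q i) * v i $ k) \<in> \<int>) \<longrightarrow> (\<forall>i\<in>I. q i = 0))"

text \<open>Induction on \<open>J\<close>: each step turns one coordinate from a character into a
  continuous function. That step requires the averages against all Fourier modes of the new
  coordinate, so the statement carries a character on \<open>I - J\<close> with arbitrary exponents
  \<open>q\<close>.\<close>

lemma box_avg_circle_functions_character:
  fixes v :: "'i \<Rightarrow> real ^ 'n" and h :: "'i \<Rightarrow> complex \<Rightarrow> real" and q :: "'i \<Rightarrow> int"
  assumes I: "finite I" and v: "int_independent I v"
    and h: "\<And>i. i \<in> I \<Longrightarrow> continuous_on (sphere 0 1) (h i)"
    and h1: "\<And>i z. i \<in> I \<Longrightarrow> z \<in> sphere 0 1 \<Longrightarrow> \<bar>h i z\<bar> \<le> 1"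
    and J: "J \<subseteq> I"
  shows "(box_avg (\<lambda>x. (\<Prod>i\<in>J. of_real (h i (cis (2 * pi * int_dot (v i) x)))) *
             cis (2 * pi * (\<Sum>i\<in>I - J. of_int (q i) * int_dot (v i) x)))
    \<longlongrightarrow> (\<Prod>i\<in>J. of_real (integral {0..1} (\<lambda>t. h i (cis (2 * pi * t))))) *
       (if \<forall>i\<in>I - J. q i = 0 then 1 else 0)) large_boxes"
  using finite_subset[OF J I] J
proof (induction J arbitrary: q rule: finite_induct)
  case empty
  define \<theta> :: "real ^ 'n" where "\<theta> = (\<chi> k. \<Sum>i\<in>I. of_int (q i) * v i $ k)"
  have "(\<forall>k. \<theta> $ k \<in> \<int>) \<longleftrightarrow> (\<forall>i\<in>I. q i = 0)"
    using v by (auto simp: \<theta>_def int_independent_def)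
  moreover have "(\<Sum>i\<in>I. of_int (q i) * int_dot (v i) x) = (\<Sum>k\<in>UNIV. \<theta> $ k * of_int (x $ k))" for x
    unfolding \<theta>_def int_dot_def vec_lambda_beta sum_distrib_left sum_distrib_right
    by (subst sum.swap) (simp add: mult_ac)
  ultimately show ?case
    using box_avg_character_tendsto[of \<theta>] by simp
next
  case (insert j J)
  let ?F = "\<lambda>J x. \<Prod>i\<in>J. complex_of_real (h i (cis (2 * pi * int_dot (v i) x)))"
  let ?M = "\<lambda>J. \<Prod>i\<in>J. complex_of_real (integral {0..1} (\<lambda>t. h i (cis (2 * pi * t))))"
  let ?u = "\<lambda>x. ?F J x * cis (2 * pi * (\<Sum>i\<in>I - insert j J. of_int (q i) * int_dot (v i) x))"
  have IJ: "I - J = insert j (I - insert j J)"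
    using insert by auto
  have "(box_avg (\<lambda>x. ?u x * of_real (h j (cis (2 * pi * int_dot (v j) x))))
    \<longlongrightarrow> (?M J * (if \<forall>i\<in>I - insert j J. q i = 0 then 1 else 0)) *
       of_real (integral {0..1} (\<lambda>t. h j (cis (2 * pi * t))))) large_boxes"
  proof (rule box_avg_circle_function)
    fix k :: int
    \<comment> \<open>Mode \<open>k\<close> in coordinate \<open>j\<close> merges with the remaining
      character, which gives the induction hypothesis for the exponents
      \<open>q(j := k)\<close>.\<close>
    have "(\<Sum>i\<in>I - J. of_int ((q(j := k)) i) * int_dot (v i) x)
        = of_int k * int_dot (v j) x + (\<Sum>i\<in>I - insert j J. of_int (q i) * int_dot (v i) x)" for x
      unfolding IJ using I by (subst sum.insert) (auto intro!: sum.cong)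
    then have 1: "?u x * cis (2 * pi * (of_int k * int_dot (v j) x))
        = ?F J x * cis (2 * pi * (\<Sum>i\<in>I - J. of_int ((q(j := k)) i) * int_dot (v i) x))" for x
      by (simp add: ring_distribs mult_ac flip: cis_mult)
    have 2: "(if k = 0 then ?M J * (if \<forall>i\<in>I - insert j J. q i = 0 then 1 else 0) else 0)
        = ?M J * (if \<forall>i\<in>I - J. (q(j := k)) i = 0 then 1 else 0)"
      unfolding IJ by auto
    show "(box_avg (\<lambda>x. ?u x * cis (2 * pi * (of_int k * int_dot (v j) x)))
      \<longlongrightarrow> (if k = 0 then ?M J * (if \<forall>i\<in>I - insert j J. q i = 0 then 1 else 0) else 0)) large_boxes"
      unfolding 1 2 by (rule insert.IH) (use insert.prems in auto)
  next
    fix x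
    have "norm (?F J x) \<le> 1"
      unfolding prod_norm[symmetric] using h1 insert.prems by (intro prod_le_1) auto
    then show "norm (?u x) \<le> 1"
      by (simp add: norm_mult)
  qed (use h insert.prems in auto)
  then show ?case
    using insert.hyps by (simp add: mult_ac)
qed

lemma box_avg_circle_functions:
  fixes v :: "'i \<Rightarrow> real ^ 'n" and h :: "'i \<Rightarrow> complex \<Rightarrow> real"
  assumes "finite I" "int_independent I v"
    and "\<And>i. i \<in> I \<Longrightarrow> continuous_on (sphere 0 1) (h i)"
    and "\<And>i z. i \<in> I \<Longrightarrow> z \<in> sphere 0 1 \<Longrightarrow> \<bar>h i z\<bar> \<le> 1"
  shows "(box_avg (\<lambda>x. of_real (\<Prod>i\<in>I. h i (cis (2 * pi * int_dot (v i) x))))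
    \<longlongrightarrow> of_real (\<Prod>i\<in>I. integral {0..1} (\<lambda>t. h i (cis (2 * pi * t))))) large_boxes"
  using box_avg_circle_functions_character[OF assms order_refl, where q = "\<lambda>_. 0"] by simp

section \<open>Cells of the torus and their frequencies\<close>

definition cell :: "nat \<Rightarrow> real \<Rightarrow> nat" where
  "cell D t = nat \<lfloor>real D * frac t\<rfloor>"

lemma cell_less: "D > 0 \<Longrightarrow> cell D t < D"
  using frac_lt_1[of t] by (simp add: cell_def floor_less_iff nat_less_iff frac_ge_0)

lemma cell_eq_iff:
  assumes "D > 0"
  shows "cell D t = c \<longleftrightarrow> frac t \<in> {real c / real D..<(real c + 1) / real D}"
proof -
  have "cell D t = c \<longleftrightarrow> \<lfloor>real D * frac t\<rfloor> = int c"
    by (auto simp: cell_def frac_ge_0)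
  also have "\<dots> \<longleftrightarrow> frac t \<in> {real c / real D..<(real c + 1) / real D}"
    using assms by (auto simp: floor_eq_iff field_simps)
  finally show ?thesis .
qed

lemma cis_2pi_frac: "cis (2 * pi * frac t) = cis (2 * pi * t)"
proof -
  have "cis (2 * pi * t) = cis (2 * pi * of_int \<lfloor>t\<rfloor>) * cis (2 * pi * frac t)"
    unfolding cis_mult by (simp add: frac_def algebra_simps)
  then show ?thesis by simp
qed

text \<open>With \<open>K\<close> the closed complement of the open arc, the functions
  \<open>min 1 (n * infdist z K)\<close> increase to the indicator of that arc, and dominated
  convergence gives its length. Working on the circle rather than on the interval makes continuity
  hold where the parameters 0 and 1 meet.\<close>

lemma arc_minorants:
  fixes a b :: real
  assumes "0 \<le> a" "a < b" "b \<le> 1"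
  obtains h :: "nat \<Rightarrow> complex \<Rightarrow> real" where
    "\<And>n. continuous_on UNIV (h n)" "\<And>n z. 0 \<le> h n z" "\<And>n z. h n z \<le> 1"
    "\<And>n t. frac t \<notin> {a..<b} \<Longrightarrow> h n (cis (2 * pi * t)) = 0"
    "(\<lambda>n. integral {0..1} (\<lambda>t. h n (cis (2 * pi * t)))) \<longlonglongrightarrow> b - a"
proof -
  define K where "K = (\<lambda>t. cis (2 * pi * t)) ` ({0..1} - {a<..<b})"
  have "compact K"
    unfolding K_def by (intro compact_continuous_image compact_diff continuous_intros) auto
  then have K: "closed K" by (rule compact_imp_closed)
  \<comment> \<open>\<open>infdist\<close> to the empty set is 0 by convention, which would make
    every \<open>h n\<close> vanish. The parameter 0 is never inside the open arc, so
    \<open>K\<close> is nonempty even for the full circle.\<close>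
  have "(0::real) \<in> {0..1} - {a<..<b}"
    using assms(1) by simp
  then have K0: "K \<noteq> {}"
    unfolding K_def by blast
  define h where "h = (\<lambda>n z. min 1 (real n * infdist z K))"
  have cont: "continuous_on UNIV (h n)" for n
    unfolding h_def by (intro continuous_intros)
  \<comment> \<open>The parametrization of the circle by \<open>{0..1}\<close> identifies only the
    two endpoints, and \<open>t\<close> is strictly between them: a parameter with the same image
    differs from \<open>t\<close> by an integer of absolute value below 1.\<close>
  have notK: "cis (2 * pi * t) \<notin> K" if t: "t \<in> {a<..<b}" for t
  proof
    assume "cis (2 * pi * t) \<in> K"
    then obtain s where s: "s \<in> {0..1} - {a<..<b}" "cis (2 * pi * t) = cis (2 * pi * s)"
      unfolding K_def by blast
    then have "cis (2 * pi * (t - s)) = 1"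
      by (simp add: right_diff_distrib flip: cis_divide)
    then have "cos (2 * pi * (t - s)) = 1"
      by (metis cis.sel(1) one_complex.sel(1))
    then obtain n :: int where "2 * pi * (t - s) = of_int n * 2 * pi"
      by (auto simp: cos_one_2pi_int)
    then have n: "t - s = of_int n" by simp
    moreover have "\<bar>t - s\<bar> < 1"
      using s(1) t assms by (auto simp: abs_if)
    ultimately have "n = 0" by linarith
    with n s(1) t show False by simp
  qed
  have h0: "h n (cis (2 * pi * t)) = 0" if "cis (2 * pi * t) \<in> K" for n t
    using that by (simp add: h_def)
  have lim: "(\<lambda>n. h n (cis (2 * pi * t))) \<longlonglongrightarrow> (if t \<in> {a<..<b} then 1 else 0)"
    if t: "t \<in> {0..1}" for t
  proof (cases "t \<in> {a<..<b}")
    case True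
    define d where "d = infdist (cis (2 * pi * t)) K"
    have "d > 0"
      unfolding d_def using notK[OF True] K K0 by (simp add: infdist_pos_not_in_closed)
    then obtain N :: nat where N: "1 / d < real N"
      using reals_Archimedean2 by blast
    have "h n (cis (2 * pi * t)) = 1" if "n \<ge> N" for n
    proof -
      have "1 / d < real n" using N that by linarith
      then have "1 \<le> real n * d" using \<open>d > 0\<close> by (simp add: field_simps)
      then show ?thesis by (simp add: h_def d_def)
    qed
    then have "(\<lambda>n. h n (cis (2 * pi * t))) \<longlonglongrightarrow> 1"
      by (intro tendsto_eventually) (auto simp: eventually_sequentially)
    with True show ?thesis by simp
  next
    case False
    with t have "cis (2 * pi * t) \<in> K" by (auto simp: K_def)
    with False h0 show ?thesis by auto
  qed
  have "((\<lambda>t. if t \<in> box a b then 1 else 0 :: real) has_integral (b - a)) (cbox 0 1)"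
    using assms has_integral_const_real[of "1::real" a b]
    by (intro has_integral_restrict_open_subinterval) auto
  then have "integral {0..1} (\<lambda>t. if t \<in> {a<..<b} then 1 else 0 :: real) = b - a"
    by (simp add: integral_unique box_real)
  moreover have "(\<lambda>n. integral {0..1} (\<lambda>t. h n (cis (2 * pi * t))))
      \<longlonglongrightarrow> integral {0..1} (\<lambda>t. if t \<in> {a<..<b} then 1 else 0 :: real)"
  proof (rule dominated_convergence(2))
    show "(\<lambda>t. h n (cis (2 * pi * t))) integrable_on {0..1}" for n
      by (intro integrable_continuous_real continuous_on_compose2[OF cont]) (auto intro!: continuous_intros)
    show "(\<lambda>_. 1::real) integrable_on {0..1::real}"
      by (intro integrable_continuous_real continuous_on_const)
    show "norm (h n (cis (2 * pi * t))) \<le> 1" for n t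
      by (simp add: h_def infdist_nonneg)
  qed (use lim in auto)
  ultimately have "(\<lambda>n. integral {0..1} (\<lambda>t. h n (cis (2 * pi * t)))) \<longlonglongrightarrow> b - a"
    by simp
  moreover have "h n (cis (2 * pi * t)) = 0" if t: "frac t \<notin> {a..<b}" for n t
  proof -
    have "frac t \<in> {0..1} - {a<..<b}"
      using t frac_lt_1[of t] by (auto simp: frac_ge_0)
    then have "cis (2 * pi * t) \<in> K"
      unfolding K_def using cis_2pi_frac by (metis (no_types, lifting) imageI)
    then show ?thesis by (rule h0)
  qed
  ultimately show thesis
    using cont by (intro that[of h]) (auto simp: h_def infdist_nonneg)
qed

lemma box_avg_of_real:
  "box_avg (\<lambda>x. of_real (f x)) P = of_real ((\<Sum>x\<in>P. f x) / real (card P))"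
  by (simp add: box_avg_def)

text \<open>A product of arc minorants lies below the indicator of the cell, so its averages bound
  the density from below. Their limit is the product of the one-dimensional integrals, and each of
  these tends to the side length \<open>1 / real D\<close>.\<close>

lemma box_density_cell_ge:
  fixes v :: "'i \<Rightarrow> real ^ 'n"
  assumes I: "finite I" and v: "int_independent I v" and D: "D > 0"
    and c: "c \<in> I \<rightarrow>\<^sub>E {..<D}" and e: "e > 0"
  shows "eventually (\<lambda>P. box_density {x. \<forall>i\<in>I. cell D (int_dot (v i) x) = c i} P
    > 1 / real D ^ card I - e) large_boxes"
proof -
  define A where "A = {x :: int ^ 'n. \<forall>i\<in>I. cell D (int_dot (v i) x) = c i}"
  let ?Q = "\<lambda>i (h :: nat \<Rightarrow> complex \<Rightarrow> real). (\<forall>n. continuous_on UNIV (h n)) \<and> (\<forall>n z. 0 \<le> h n z \<and> h n z \<le> 1) \<and>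
      (\<forall>n t. cell D t \<noteq> c i \<longrightarrow> h n (cis (2 * pi * t)) = 0) \<and>
      (\<lambda>n. integral {0..1} (\<lambda>t. h n (cis (2 * pi * t)))) \<longlonglongrightarrow> 1 / real D"
  have "\<exists>h. ?Q i h" if "i \<in> I" for i
  proof -
    have "real (Suc (c i)) \<le> real D"
      using PiE_mem[OF c that] by (intro of_nat_mono) auto
    then have "0 \<le> real (c i) / real D" "real (c i) / real D < (real (c i) + 1) / real D"
      "(real (c i) + 1) / real D \<le> 1"
      using D by (auto simp: divide_simps)
    then obtain h :: "nat \<Rightarrow> complex \<Rightarrow> real" where h: "\<And>n. continuous_on UNIV (h n)" "\<And>n z. 0 \<le> h n z" "\<And>n z. h n z \<le> 1"
      "\<And>n t. frac t \<notin> {real (c i) / real D..<(real (c i) + 1) / real D} \<Longrightarrow> h n (cis (2 * pi * t)) = 0"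
      "(\<lambda>n. integral {0..1} (\<lambda>t. h n (cis (2 * pi * t)))) \<longlonglongrightarrow> (real (c i) + 1) / real D - real (c i) / real D"
      by (rule arc_minorants) blast
    have "(real (c i) + 1) / real D - real (c i) / real D = 1 / real D"
      by (simp add: diff_divide_distrib[symmetric])
    with h show ?thesis
      unfolding cell_eq_iff[OF D] by (intro exI[of _ h]) auto
  qed
  then have "\<forall>i\<in>I. \<exists>h. ?Q i h" by blast
  then obtain h where Q: "\<forall>i\<in>I. ?Q i (h i)"
    by (rule bchoice[THEN exE])
  then have cont: "continuous_on UNIV (h i n)"
    and h01: "0 \<le> h i n z \<and> h i n z \<le> 1"
    and h0: "cell D t \<noteq> c i \<Longrightarrow> h i n (cis (2 * pi * t)) = 0"
    and lim: "(\<lambda>n. integral {0..1} (\<lambda>t. h i n (cis (2 * pi * t)))) \<longlonglongrightarrow> 1 / real D"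
    if "i \<in> I" for i n z t
    using that by blast+
  have "(\<lambda>n. \<Prod>i\<in>I. integral {0..1} (\<lambda>t. h i n (cis (2 * pi * t)))) \<longlonglongrightarrow> (\<Prod>i\<in>I. 1 / real D)"
    by (intro tendsto_prod lim)
  then have "(\<lambda>n. \<Prod>i\<in>I. integral {0..1} (\<lambda>t. h i n (cis (2 * pi * t)))) \<longlonglongrightarrow> 1 / real D ^ card I"
    by (simp add: power_one_over)
  from order_tendstoD(1)[OF this, of "1 / real D ^ card I - e"] e
  obtain n where n: "(\<Prod>i\<in>I. integral {0..1} (\<lambda>t. h i n (cis (2 * pi * t)))) > 1 / real D ^ card I - e"
    by (auto simp: eventually_sequentially)
  let ?f = "\<lambda>x. \<Prod>i\<in>I. h i n (cis (2 * pi * int_dot (v i) x))"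
  have "(box_avg (\<lambda>x. of_real (?f x)) \<longlongrightarrow>
      of_real (\<Prod>i\<in>I. integral {0..1} (\<lambda>t. h i n (cis (2 * pi * t))))) large_boxes"
    using h01 by (intro box_avg_circle_functions I v) (auto intro: continuous_on_subset[OF cont])
  then have "((\<lambda>P. Re (box_avg (\<lambda>x. of_real (?f x)) P)) \<longlongrightarrow>
      (\<Prod>i\<in>I. integral {0..1} (\<lambda>t. h i n (cis (2 * pi * t))))) large_boxes"
    by (drule_tac tendsto_Re) (simp del: of_real_prod)
  from order_tendstoD(1)[OF this n] eventually_box_finite
  show ?thesis
    unfolding A_def[symmetric]
  proof eventually_elim
    case (elim P)
    have "(\<Sum>x\<in>P. ?f x) \<le> (\<Sum>x\<in>P. indicator A x)"
    proof (rule sum_mono)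
      fix x
      show "?f x \<le> indicator A x"
      proof (cases "x \<in> A")
        case True
        then show ?thesis using h01 by (simp add: prod_le_1)
      next
        case False
        then obtain i where "i \<in> I" "cell D (int_dot (v i) x) \<noteq> c i"
          by (auto simp: A_def)
        then have "?f x = 0"
          using h0 I by (intro prod_zero) auto
        then show ?thesis by simp
      qed
    qed
    also have "\<dots> = real (card (A \<inter> P))"
      using elim by (simp add: indicator_def sum.If_cases Int_commute)
    finally have "(\<Sum>x\<in>P. ?f x) / real (card P) \<le> box_density A P"
      unfolding box_density_def by (rule divide_right_mono) simp
    moreover have "Re (box_avg (\<lambda>x. of_real (?f x)) P) = (\<Sum>x\<in>P. ?f x) / real (card P)"
      unfolding box_avg_of_real by (simp only: Re_complex_of_real)
    ultimately show ?case using elim by linarith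
  qed
qed

lemma box_density_cell_tendsto:
  fixes v :: "'i \<Rightarrow> real ^ 'n"
  assumes I: "finite I" and v: "int_independent I v" and D: "D > 0"
    and c: "c \<in> I \<rightarrow>\<^sub>E {..<D}"
  shows "(box_density {x. \<forall>i\<in>I. cell D (int_dot (v i) x) = c i} \<longlongrightarrow> 1 / real D ^ card I) large_boxes"
proof (rule tendstoI)
  \<comment> \<open>The \<open>D ^ card I\<close> disjoint cells exhaust the lattice, so the lower bounds for all the other
    cells yield the upper bound for this one.\<close>
  fix e :: real assume e: "e > 0"
  define C where "C = (I \<rightarrow>\<^sub>E {..<D})"
  define M where "M = real D ^ card I"
  define A where "A = (\<lambda>c. {x :: int ^ 'n. \<forall>i\<in>I. cell D (int_dot (v i) x) = c i})"
  have C: "finite C" "real (card C) = M" "c \<in> C"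
    using I c by (auto simp: C_def M_def finite_PiE card_PiE)
  have M: "M \<ge> 1" using D by (simp add: M_def)
  \<comment> \<open>With tolerance \<open>e / M\<close> per cell, the \<open>M - 1\<close> other
    cells together lose less than \<open>e\<close>, which bounds the excess of the cell
    \<open>c\<close>.\<close>
  have "eventually (\<lambda>P. \<forall>c\<in>C. box_density (A c) P > 1 / M - e / M) large_boxes"
    unfolding A_def M_def C_def using e M D
    by (intro eventually_ball_finite finite_PiE ballI box_density_cell_ge I v D) auto
  with eventually_box_finite
  show "eventually (\<lambda>P. dist (box_density {x. \<forall>i\<in>I. cell D (int_dot (v i) x) = c i} P) (1 / real D ^ card I) < e) large_boxes"
    unfolding M_def[symmetric]
  proof eventually_elim
    case (elim P)
    have "(\<Union>c\<in>C. A c) = UNIV"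
    proof (intro equalityI subsetI)
      fix x :: "int ^ 'n"
      have "(\<lambda>i\<in>I. cell D (int_dot (v i) x)) \<in> C" "x \<in> A (\<lambda>i\<in>I. cell D (int_dot (v i) x))"
        using cell_less[OF D] by (auto simp: C_def A_def)
      then show "x \<in> (\<Union>c\<in>C. A c)" by blast
    qed simp
    moreover have "disjoint_family_on A C"
      unfolding disjoint_family_on_def
    proof (intro ballI impI equals0I)
      fix c c' x assume "c \<in> C" "c' \<in> C" "c \<noteq> c'" and x: "x \<in> A c \<inter> A c'"
      moreover have "c i = c' i" if "i \<in> I" for i
        using x that unfolding A_def by fastforce
      ultimately show False
        unfolding C_def using PiE_ext by metis
    qed
    ultimately have "(\<Sum>c\<in>C. box_density (A c) P) = box_density UNIV P"
      using box_density_UN[of C P A] C elim by simp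
    also have "\<dots> = 1"
      using elim by (auto simp: box_density_def)
    finally have "box_density (A c) P + (\<Sum>c'\<in>C - {c}. box_density (A c') P) = 1"
      using C by (simp add: sum.remove)
    moreover have "(\<Sum>c'\<in>C - {c}. box_density (A c') P) \<ge> (\<Sum>c'\<in>C - {c}. 1 / M - e / M)"
      using elim by (intro sum_mono) force
    moreover have "(\<Sum>c'\<in>C - {c}. 1 / M - e / M) = (M - 1) * (1 / M - e / M)"
    proof -
      have "card C > 0" using C by (auto simp: card_gt_0_iff)
      then have "real (card (C - {c})) = M - 1"
        using C by (simp add: of_nat_diff Suc_le_eq)
      then show ?thesis by simp
    qed
    moreover have "(M - 1) * (1 / M - e / M) = 1 - 1 / M - e + e / M"
      using M by (simp add: field_simps)
    moreover have "e / M \<le> e" "e / M > 0"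
      using M e by (auto simp: divide_le_eq)
    moreover have "box_density (A c) P > 1 / M - e / M"
      using elim C by blast
    ultimately have "\<bar>box_density (A c) P - 1 / M\<bar> < e"
      by linarith
    then show ?case
      by (simp add: dist_real_def A_def)
  qed
qed

section \<open>Dyadic approximation of Jordan measurable sets\<close>

abbreviation unit_cube :: "nat \<Rightarrow> (nat \<Rightarrow> real) set" where
  "unit_cube m \<equiv> {..<m} \<rightarrow>\<^sub>E {0..<1}"

definition cells :: "nat \<Rightarrow> nat \<Rightarrow> (nat \<Rightarrow> real) \<Rightarrow> nat \<Rightarrow> nat" where
  "cells m D y = (\<lambda>i\<in>{..<m}. cell D (y i))"

definition inner_cells :: "nat \<Rightarrow> (nat \<Rightarrow> real) set \<Rightarrow> nat \<Rightarrow> (nat \<Rightarrow> nat) set" where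
  "inner_cells m G D = {c \<in> {..<m} \<rightarrow>\<^sub>E {..<D}. \<forall>y\<in>unit_cube m. cells m D y = c \<longrightarrow> y \<in> G}"

definition outer_cells :: "nat \<Rightarrow> (nat \<Rightarrow> real) set \<Rightarrow> nat \<Rightarrow> (nat \<Rightarrow> nat) set" where
  "outer_cells m G D = cells m D ` G"

lemma cells_in: "D > 0 \<Longrightarrow> cells m D y \<in> {..<m} \<rightarrow>\<^sub>E {..<D}"
  by (simp add: cells_def cell_less)

lemma cells_eq_iff: "cells m D y = cells m D z \<longleftrightarrow> (\<forall>i<m. cell D (y i) = cell D (z i))"
  by (auto simp: cells_def fun_eq_iff)

lemma unit_cube_cell_eq_image:
  assumes "D > 0" "c \<in> {..<m} \<rightarrow>\<^sub>E {..<D}"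
  shows "{y \<in> unit_cube m. cells m D y = c} =
    PiE {..<m} (\<lambda>i. {real (c i) / real D..<(real (c i) + 1) / real D})"
    (is "?A = PiE _ ?B")
proof -
  have B: "?B i \<subseteq> {0..<1}" if "i < m" for i
  proof -
    have "c i < D" using assms(2) that by auto
    then have "(real (c i) + 1) / real D \<le> 1" "0 \<le> real (c i) / real D"
      using assms(1) by (auto simp: divide_le_eq_1)
    then show ?thesis by auto
  qed
  have eq: "cell D t = c i \<longleftrightarrow> t \<in> ?B i" if "t \<in> {0..<1}" for t i
    using that assms(1) by (subst cell_eq_iff) (simp_all add: frac_eq)
  show ?thesis
  proof (intro equalityI subsetI)
    fix y assume "y \<in> ?A"
    then have y: "y \<in> unit_cube m" "cells m D y = c"
      by simp_all
    show "y \<in> PiE {..<m} ?B"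
    proof (rule PiE_I)
      fix i assume "i \<in> {..<m}"
      then show "y i \<in> ?B i"
        using PiE_mem[OF y(1), of i] fun_cong[OF y(2), of i] eq[of "y i" i] by (simp add: cells_def)
    qed (rule PiE_arb[OF y(1)])
  next
    fix y assume y: "y \<in> PiE {..<m} ?B"
    then have y1: "y \<in> unit_cube m"
      using B PiE_mono[of "{..<m}" ?B "\<lambda>_. {0..<1}"] by auto
    moreover have "cells m D y = c"
    proof (rule PiE_ext[OF cells_in[OF assms(1)] assms(2)])
      fix i assume "i \<in> {..<m}"
      then show "cells m D y i = c i"
        using PiE_mem[OF y1, of i] PiE_mem[OF y, of i] eq[of "y i" i] by (simp add: cells_def)
    qed
    ultimately show "y \<in> ?A" by simp
  qed
qed

lemma inner_cells_subset: "inner_cells m G D \<subseteq> {..<m} \<rightarrow>\<^sub>E {..<D}"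
  by (auto simp: inner_cells_def)

lemma outer_cells_subset: "D > 0 \<Longrightarrow> outer_cells m G D \<subseteq> {..<m} \<rightarrow>\<^sub>E {..<D}"
  using cells_in by (auto simp: outer_cells_def)

lemma inner_cells_subset_outer_cells:
  assumes "D > 0"
  shows "inner_cells m G D \<subseteq> outer_cells m G D"
proof
  fix c assume c: "c \<in> inner_cells m G D"
  then have cD: "c \<in> {..<m} \<rightarrow>\<^sub>E {..<D}"
    by (simp add: inner_cells_def)
  \<comment> \<open>The lower corner shows that the cell is nonempty; an empty cell would satisfy
    the condition for an inner cell vacuously.\<close>
  have "(\<lambda>i\<in>{..<m}. real (c i) / real D) \<in>
      PiE {..<m} (\<lambda>i. {real (c i) / real D..<(real (c i) + 1) / real D})"
    using assms by (auto simp: divide_strict_right_mono)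
  then obtain y where "y \<in> unit_cube m" "cells m D y = c"
    unfolding unit_cube_cell_eq_image[OF assms cD, symmetric] by blast
  then show "c \<in> outer_cells m G D"
    using c by (auto simp: inner_cells_def outer_cells_def)
qed

lemma cell_div_2: "cell D t = cell (2 * D) t div 2"
proof -
  have "\<lfloor>real D * frac t\<rfloor> = \<lfloor>(real (2 * D) * frac t) / of_int 2\<rfloor>"
    by simp
  also have "\<dots> = \<lfloor>real (2 * D) * frac t\<rfloor> div 2"
    by (rule floor_divide_real_eq_div) simp
  finally show ?thesis
    by (simp add: cell_def nat_div_distrib frac_ge_0)
qed

text \<open>Nesting of the cells under doubling of the order: a boundary cell of order
  \<open>2 * D\<close> lies in a boundary cell of order \<open>D\<close>.\<close>

lemma cells_eq_refine:
  "cells m (2 * D) y = cells m (2 * D) z \<Longrightarrow> cells m D y = cells m D z"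
  unfolding cells_eq_iff using cell_div_2[of D] by metis

lemma cell_eq_imp_close:
  assumes "D > 0" "s \<in> {0..<1}" "t \<in> {0..<1}" "cell D s = cell D t"
  shows "\<bar>s - t\<bar> < 1 / real D"
proof -
  have "s \<in> {real (cell D t) / real D..<(real (cell D t) + 1) / real D}"
    "t \<in> {real (cell D t) / real D..<(real (cell D t) + 1) / real D}"
    using assms cell_eq_iff[of D s "cell D t"] cell_eq_iff[of D t "cell D t"]
    by (auto simp: frac_eq)
  then show ?thesis
    by (auto simp: add_divide_distrib abs_if)
qed

text \<open>The points whose dyadic cells of every order meet both \<open>G\<close> and its complement are
  frontier points of \<open>G\<close>.\<close>

lemma card_outer_minus_inner_tendsto:
  assumes G: "G \<subseteq> unit_cube m" and J: "jordan_measurable m G"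
  shows "(\<lambda>j. real (card (outer_cells m G (2 ^ j) - inner_cells m G (2 ^ j))) / real (2 ^ j) ^ m) \<longlonglongrightarrow> 0"
proof -
  interpret product_sigma_finite "\<lambda>_::nat. lborel :: real measure"
    by unfold_locales
  define M where "M = (\<Pi>\<^sub>M i\<in>{..<m}. (lborel :: real measure))"
  define X where "X = product_topology (\<lambda>_::nat. euclideanreal) {..<m}"
  define S where "S = (\<lambda>j::nat. outer_cells m G (2 ^ j) - inner_cells m G (2 ^ j))"
  define cube where "cube = (\<lambda>j c. {y \<in> unit_cube m. cells m (2 ^ j) y = c})"
  \<comment> \<open>The union of the boundary cells of order \<open>2 ^ j\<close>. Its measure is
    the quotient in the claim, so continuity of measure along a decreasing sequence gives the
    limit.\<close>
  define B where "B = (\<lambda>j. \<Union>c\<in>S j. cube j c)"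
  have S: "S j \<subseteq> {..<m} \<rightarrow>\<^sub>E {..<2 ^ j}" for j
    using outer_cells_subset[of "2 ^ j" m G] by (auto simp: S_def)
  then have finS: "finite (S j)" for j
    by (rule finite_subset) (simp add: finite_PiE)
  have cube: "cube j c \<in> sets M" "emeasure M (cube j c) = ennreal (1 / (2 ^ j) ^ m)"
    if "c \<in> S j" for j c
  proof -
    have c: "cube j c = PiE {..<m} (\<lambda>i. {real (c i) / real (2 ^ j)..<(real (c i) + 1) / real (2 ^ j)})"
      unfolding cube_def by (rule unit_cube_cell_eq_image) (use S that in auto)
    show "cube j c \<in> sets M"
      unfolding c M_def by (intro sets_PiM_I_finite) auto
    have "emeasure M (cube j c) =
        (\<Prod>i<m. emeasure lborel {real (c i) / real (2 ^ j)..<(real (c i) + 1) / real (2 ^ j)})"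
      unfolding c M_def by (rule emeasure_PiM) auto
    also have "\<dots> = (\<Prod>i<m. ennreal (1 / 2 ^ j))"
      by (intro prod.cong refl) (simp add: add_divide_distrib divide_right_mono)
    also have "\<dots> = ennreal (1 / (2 ^ j) ^ m)"
      by (simp add: ennreal_power power_one_over)
    finally show "emeasure M (cube j c) = ennreal (1 / (2 ^ j) ^ m)" .
  qed
  have disj: "disjoint_family_on (cube j) (S j)" for j
    by (auto simp: disjoint_family_on_def cube_def)
  have Bsets: "B j \<in> sets M" for j
    unfolding B_def using finS cube by (intro sets.finite_UN) auto
  have "measure M (B j) = (\<Sum>c\<in>S j. measure M (cube j c))" for j
    unfolding B_def using cube by (intro measure_finite_Union finS disj) auto
  then have measB: "measure M (B j) = real (card (S j)) / (2 ^ j) ^ m" for j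
    using cube by (simp add: measure_def)
  have B_iff: "y \<in> B j \<longleftrightarrow> y \<in> unit_cube m \<and> (\<exists>g\<in>G. cells m (2 ^ j) g = cells m (2 ^ j) y)
      \<and> (\<exists>g\<in>unit_cube m - G. cells m (2 ^ j) g = cells m (2 ^ j) y)" for j y
    using cells_in[of "2 ^ j" m y]
    by (auto simp: B_def cube_def S_def outer_cells_def inner_cells_def image_iff) metis
  have "decseq B"
  proof (rule decseq_SucI, rule subsetI)
    fix j y assume "y \<in> B (Suc j)"
    then show "y \<in> B j"
      unfolding B_iff power_Suc using cells_eq_refine by blast
  qed
  have fin: "emeasure M (B j) \<noteq> \<infinity>" for j
  proof -
    have "emeasure M (B j) = (\<Sum>c\<in>S j. emeasure M (cube j c))"
      unfolding B_def using cube by (intro sum_emeasure[symmetric] finS disj) auto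
    then show ?thesis
      using cube finS by (simp add: ennreal_mult_eq_top_iff)
  qed
  have "(\<Inter>j. B j) \<subseteq> X frontier_of G"
  proof
    fix y assume y: "y \<in> (\<Inter>j. B j)"
    then have "y \<in> B 0" by blast
    then have yU: "y \<in> unit_cube m"
      using B_iff[of y 0] by (rule iffD1[THEN conjunct1, rotated])
    have near: "(\<exists>g\<in>G. g \<in> T) \<and> (\<exists>g. g \<notin> G \<and> g \<in> T)" if T: "openin X T" "y \<in> T" for T
    proof -
      obtain U where U: "\<forall>i\<in>{..<m}. openin euclideanreal (U i)" "y \<in> Pi\<^sub>E {..<m} U" "Pi\<^sub>E {..<m} U \<subseteq> T"
        using T unfolding X_def openin_product_topology_alt by blast
      have "\<forall>i\<in>{..<m}. \<exists>e>0. \<forall>t. \<bar>t - y i\<bar> < e \<longrightarrow> t \<in> U i"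
      proof
        fix i assume "i \<in> {..<m}"
        with U have "open (U i)" "y i \<in> U i" by auto
        then show "\<exists>e>0. \<forall>t. \<bar>t - y i\<bar> < e \<longrightarrow> t \<in> U i"
          unfolding open_dist dist_real_def by blast
      qed
      then obtain e where e: "\<forall>i\<in>{..<m}. e i > 0 \<and> (\<forall>t. \<bar>t - y i\<bar> < e i \<longrightarrow> t \<in> U i)"
        by (rule bchoice[THEN exE])
      \<comment> \<open>A basic neighbourhood constrains only \<open>m\<close> coordinates, so a
        single order \<open>j\<close> has cells narrower than all the radii \<open>e i\<close>; the
        whole cell of \<open>y\<close> then lies in \<open>T\<close>.\<close>
      have "eventually (\<lambda>j. \<forall>i\<in>{..<m}. (1/2) ^ j < e i) sequentially"
      proof (intro eventually_ball_finite ballI)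
        fix i assume "i \<in> {..<m}"
        then show "eventually (\<lambda>j. (1/2) ^ j < e i) sequentially"
          using e by (intro order_tendstoD(2)[OF LIMSEQ_realpow_zero]) auto
      qed simp
      then obtain j where j: "\<forall>i\<in>{..<m}. (1/2) ^ j < e i"
        by (auto simp: eventually_sequentially)
      have inT: "g \<in> T" if g: "g \<in> unit_cube m" "cells m (2 ^ j) g = cells m (2 ^ j) y" for g
      proof -
        have "g i \<in> U i" if i: "i < m" for i
        proof -
          have "\<bar>g i - y i\<bar> < 1 / real (2 ^ j)"
            using g i PiE_mem[OF g(1), of i] PiE_mem[OF yU, of i]
            by (intro cell_eq_imp_close) (auto simp: cells_eq_iff)
          also have "\<dots> = (1/2) ^ j"
            by (simp add: power_one_over)
          finally have "\<bar>g i - y i\<bar> < e i"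
            using j i by force
          then show ?thesis
            using e i by blast
        qed
        then have "g \<in> Pi\<^sub>E {..<m} U"
          using g(1) by (auto simp: PiE_iff)
        then show ?thesis using U by blast
      qed
      have "y \<in> B j" using y by blast
      then show ?thesis
        unfolding B_iff using inT G by blast
    qed
    have "y \<in> X closure_of G"
      using near yU by (auto simp: in_closure_of X_def PiE_iff)
    moreover have "y \<notin> X interior_of G"
      using near by (auto simp: interior_of_def)
    ultimately show "y \<in> X frontier_of G"
      by (simp add: frontier_of_def)
  qed
  \<comment> \<open>The frontier is null for the completed measure, hence so is its subset; since
    the intersection belongs to \<open>sets M\<close>, it is null for \<open>M\<close>
    itself.\<close>
  then have "(\<Inter>j. B j) \<in> null_sets (completion M)"
    using J null_sets_completion_subset unfolding jordan_measurable_def X_def M_def by blast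
  moreover have "(\<Inter>j. B j) \<in> sets M"
    using Bsets by (intro sets.countable_INT) auto
  ultimately have "measure M (\<Inter>j. B j) = 0"
    by (simp add: null_sets_completion_iff measure_eq_0_null_sets)
  moreover have "(\<lambda>j. measure M (B j)) \<longlonglongrightarrow> measure M (\<Inter>j. B j)"
    using Bsets \<open>decseq B\<close> fin by (intro Lim_measure_decseq) auto
  ultimately show ?thesis
    unfolding measB S_def by simp
qed

section \<open>Densities of quasiperiodic sets\<close>

text \<open>A point has exactly one representative modulo integers in the unit cube, so the integer
  shift \<open>z\<close> can only be the vector of floors.\<close>

lemma quasiperiodic_set_iff:
  assumes "G \<subseteq> unit_cube m"
  shows "x \<in> quasiperiodic_set m G \<Lambda> \<longleftrightarrow> (\<lambda>i\<in>{..<m}. frac (int_dot (\<Lambda> i) x)) \<in> G"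
proof
  assume "x \<in> quasiperiodic_set m G \<Lambda>"
  then obtain g and z :: "nat \<Rightarrow> int"
    where g: "g \<in> G" "mat_apply m \<Lambda> x = (\<lambda>i\<in>{..<m}. g i + of_int (z i))"
    by (auto simp: quasiperiodic_set_def)
  have gU: "g \<in> unit_cube m" using g(1) assms by blast
  have "(\<lambda>i\<in>{..<m}. frac (int_dot (\<Lambda> i) x)) = g"
  proof (rule PiE_ext[OF _ gU])
    show "(\<lambda>i\<in>{..<m}. frac (int_dot (\<Lambda> i) x)) \<in> unit_cube m"
      by (simp add: frac_ge_0 frac_lt_1)
    fix i assume i: "i \<in> {..<m}"
    then have "int_dot (\<Lambda> i) x = g i + of_int (z i)"
      using fun_cong[OF g(2), of i] by (simp add: mat_apply_def int_dot_def)
    moreover have "g i \<in> {0..<1}" using PiE_mem[OF gU i] .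
    ultimately show "(\<lambda>i\<in>{..<m}. frac (int_dot (\<Lambda> i) x)) i = g i"
      using i by (simp add: frac_unique_iff)
  qed
  with g(1) show "(\<lambda>i\<in>{..<m}. frac (int_dot (\<Lambda> i) x)) \<in> G" by simp
next
  assume "(\<lambda>i\<in>{..<m}. frac (int_dot (\<Lambda> i) x)) \<in> G"
  moreover have "mat_apply m \<Lambda> x =
      (\<lambda>i\<in>{..<m}. (\<lambda>i\<in>{..<m}. frac (int_dot (\<Lambda> i) x)) i + of_int \<lfloor>int_dot (\<Lambda> i) x\<rfloor>)"
    by (auto simp: mat_apply_def int_dot_def frac_def)
  ultimately show "x \<in> quasiperiodic_set m G \<Lambda>"
    unfolding quasiperiodic_set_def mem_Collect_eq
    by (intro bexI[of _ "\<lambda>i\<in>{..<m}. frac (int_dot (\<Lambda> i) x)"] exI)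
qed

definition cell_set :: "nat \<Rightarrow> (nat \<Rightarrow> real ^ 'n) \<Rightarrow> nat \<Rightarrow> (nat \<Rightarrow> nat) set \<Rightarrow> (int ^ 'n) set" where
  "cell_set m \<Lambda> D S = {x. cells m D (\<lambda>i. int_dot (\<Lambda> i) x) \<in> S}"

lemma cells_frac: "cells m D (\<lambda>i\<in>{..<m}. frac (f i)) = cells m D f"
  unfolding cells_eq_iff by (simp add: cell_def frac_def)

lemma quasiperiodic_set_sandwich:
  assumes "G \<subseteq> unit_cube m" "D > 0"
  shows "cell_set m \<Lambda> D (inner_cells m G D) \<subseteq> quasiperiodic_set m G \<Lambda>"
    and "quasiperiodic_set m G \<Lambda> \<subseteq> cell_set m \<Lambda> D (outer_cells m G D)"
proof -
  have "(\<lambda>i\<in>{..<m}. frac (int_dot (\<Lambda> i) x)) \<in> unit_cube m" for x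
    by (simp add: frac_ge_0 frac_lt_1)
  then show "cell_set m \<Lambda> D (inner_cells m G D) \<subseteq> quasiperiodic_set m G \<Lambda>"
    using cells_frac[of m D "\<lambda>i. int_dot (\<Lambda> i) _"]
    by (auto simp: cell_set_def inner_cells_def quasiperiodic_set_iff[OF assms(1)])
  show "quasiperiodic_set m G \<Lambda> \<subseteq> cell_set m \<Lambda> D (outer_cells m G D)"
    using cells_frac[of m D "\<lambda>i. int_dot (\<Lambda> i) _", symmetric]
    by (auto simp: cell_set_def outer_cells_def quasiperiodic_set_iff[OF assms(1)])
qed

text \<open>Choosing one cell from each \<open>S k\<close> splits the intersection into disjoint
  pieces. Each piece is a single cell for the pooled rows, of frequency
  \<open>1 / real D ^ card I\<close>; there are as many pieces as the product of the
  \<open>card (S k)\<close>, and \<open>card I\<close> is the sum of the \<open>m k\<close>, so the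
  total factors over \<open>K\<close>.\<close>

lemma box_density_Int_cell_sets:
  fixes \<Lambda> :: "'k \<Rightarrow> nat \<Rightarrow> real ^ 'n"
  assumes K: "finite K" and D: "D > 0"
    and S: "\<And>k. k \<in> K \<Longrightarrow> S k \<subseteq> {..<m k} \<rightarrow>\<^sub>E {..<D}"
    and v: "int_independent (SIGMA k:K. {..<m k}) (\<lambda>(k, i). \<Lambda> k i)"
  shows "(box_density (\<Inter>k\<in>K. cell_set (m k) (\<Lambda> k) D (S k))
    \<longlongrightarrow> (\<Prod>k\<in>K. real (card (S k)) / real D ^ m k)) large_boxes"
proof -
  define I where "I = (SIGMA k:K. {..<m k})"
  define E where "E = (\<lambda>C. {x :: int ^ 'n. \<forall>k\<in>K. cells (m k) D (\<lambda>i. int_dot (\<Lambda> k i) x) = C k})"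
  have finS: "finite (S k)" if "k \<in> K" for k
    using S[OF that] by (rule finite_subset) (simp add: finite_PiE)
  have fin: "finite (Pi\<^sub>E K S)"
    using K finS by (rule finite_PiE)
  have I: "finite I" "card I = (\<Sum>k\<in>K. m k)"
    using K by (simp_all add: I_def)
  have lim: "(box_density (E C) \<longlongrightarrow> 1 / real D ^ card I) large_boxes" if C: "C \<in> Pi\<^sub>E K S" for C
  proof -
    \<comment> \<open>The chosen cells, one per group, uncurried into one cell of the pooled
      torus.\<close>
    define c where "c = (\<lambda>p\<in>I. C (fst p) (snd p))"
    have Ck: "C k \<in> {..<m k} \<rightarrow>\<^sub>E {..<D}" if "k \<in> K" for k
      using S[OF that] PiE_mem[OF C that] by blast
    have "c \<in> I \<rightarrow>\<^sub>E {..<D}"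
      unfolding c_def using PiE_mem[OF Ck] by (auto simp: I_def)
    from box_density_cell_tendsto[OF I(1) v[folded I_def] D this]
    have "(box_density {x. \<forall>p\<in>I. cell D (int_dot (case p of (k, i) \<Rightarrow> \<Lambda> k i) x) = c p} \<longlongrightarrow> 1 / real D ^ card I) large_boxes" .
    moreover have "(\<forall>p\<in>I. cell D (int_dot (case p of (k, i) \<Rightarrow> \<Lambda> k i) x) = c p)
        \<longleftrightarrow> (\<forall>k\<in>K. cells (m k) D (\<lambda>i. int_dot (\<Lambda> k i) x) = C k)" for x
    proof -
      have "cells (m k) D (\<lambda>i. int_dot (\<Lambda> k i) x) = C k
          \<longleftrightarrow> (\<forall>i<m k. cell D (int_dot (\<Lambda> k i) x) = C k i)" if k: "k \<in> K" for k
      proof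
        assume "\<forall>i<m k. cell D (int_dot (\<Lambda> k i) x) = C k i"
        then show "cells (m k) D (\<lambda>i. int_dot (\<Lambda> k i) x) = C k"
          by (intro PiE_ext[OF cells_in[OF D] Ck[OF k]]) (simp add: cells_def)
      next
        assume eq: "cells (m k) D (\<lambda>i. int_dot (\<Lambda> k i) x) = C k"
        show "\<forall>i<m k. cell D (int_dot (\<Lambda> k i) x) = C k i"
          unfolding eq[symmetric] by (simp add: cells_def)
      qed
      moreover have "(\<forall>p\<in>I. cell D (int_dot (case p of (k, i) \<Rightarrow> \<Lambda> k i) x) = c p)
          \<longleftrightarrow> (\<forall>k\<in>K. \<forall>i<m k. cell D (int_dot (\<Lambda> k i) x) = C k i)"
        by (auto simp: I_def c_def)
      ultimately show ?thesis by simp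
    qed
    ultimately show ?thesis
      unfolding E_def by simp
  qed
  have "(\<Inter>k\<in>K. cell_set (m k) (\<Lambda> k) D (S k)) = (\<Union>C\<in>Pi\<^sub>E K S. E C)"
  proof (intro equalityI subsetI)
    fix x assume "x \<in> (\<Inter>k\<in>K. cell_set (m k) (\<Lambda> k) D (S k))"
    then have "(\<lambda>k\<in>K. cells (m k) D (\<lambda>i. int_dot (\<Lambda> k i) x)) \<in> Pi\<^sub>E K S"
      "x \<in> E (\<lambda>k\<in>K. cells (m k) D (\<lambda>i. int_dot (\<Lambda> k i) x))"
      by (auto simp: cell_set_def E_def)
    then show "x \<in> (\<Union>C\<in>Pi\<^sub>E K S. E C)" by blast
  next
    fix x assume "x \<in> (\<Union>C\<in>Pi\<^sub>E K S. E C)"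
    then obtain C where "C \<in> Pi\<^sub>E K S" "x \<in> E C" by blast
    then show "x \<in> (\<Inter>k\<in>K. cell_set (m k) (\<Lambda> k) D (S k))"
      by (auto simp: cell_set_def E_def)
  qed
  moreover have "disjoint_family_on E (Pi\<^sub>E K S)"
    unfolding disjoint_family_on_def
  proof (intro ballI impI equals0I)
    fix C C' x assume C: "C \<in> Pi\<^sub>E K S" "C' \<in> Pi\<^sub>E K S" "C \<noteq> C'" and x: "x \<in> E C \<inter> E C'"
    have "C k = C' k" if "k \<in> K" for k
      using x that unfolding E_def by force
    with C show False
      using PiE_ext by metis
  qed
  ultimately have eq: "eventually (\<lambda>P. (\<Sum>C\<in>Pi\<^sub>E K S. box_density (E C) P)
      = box_density (\<Inter>k\<in>K. cell_set (m k) (\<Lambda> k) D (S k)) P) large_boxes"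
    using box_density_UN[OF fin, of _ E] eventually_box_finite by (auto elim!: eventually_mono)
  have "((\<lambda>P. \<Sum>C\<in>Pi\<^sub>E K S. box_density (E C) P) \<longlongrightarrow> (\<Sum>C\<in>Pi\<^sub>E K S. 1 / real D ^ card I)) large_boxes"
    by (intro tendsto_sum lim)
  moreover have "(\<Sum>C\<in>Pi\<^sub>E K S. 1 / real D ^ card I) = (\<Prod>k\<in>K. real (card (S k)) / real D ^ m k)"
    using K by (simp add: card_PiE I prod_dividef power_sum)
  ultimately show ?thesis
    using tendsto_cong[OF eq] by simp
qed

lemma box_density_tendsto_sandwich:
  assumes "a \<longlonglongrightarrow> g" "b \<longlonglongrightarrow> g"
    and "\<And>j::nat. (box_density (L j) \<longlongrightarrow> a j) large_boxes" "\<And>j. (box_density (U j) \<longlongrightarrow> b j) large_boxes"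
    and "\<And>j. L j \<subseteq> A" "\<And>j. A \<subseteq> U j"
  shows "(box_density A \<longlongrightarrow> g) large_boxes"
proof (rule order_tendstoI)
  fix y assume "y < g"
  from order_tendstoD(1)[OF assms(1) this] obtain j where "y < a j"
    by (auto simp: eventually_sequentially)
  from order_tendstoD(1)[OF assms(3) this] eventually_box_finite
  show "eventually (\<lambda>P. y < box_density A P) large_boxes"
  proof eventually_elim
    case (elim P)
    then show ?case using box_density_mono[OF _ assms(5), of P j] by linarith
  qed
next
  fix y assume "g < y"
  from order_tendstoD(2)[OF assms(2) this] obtain j where "b j < y"
    by (auto simp: eventually_sequentially)
  from order_tendstoD(2)[OF assms(4) this] eventually_box_finite
  show "eventually (\<lambda>P. box_density A P < y) large_boxes"
  proof eventually_elim
    case (elim P)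
    then show ?case using box_density_mono[OF _ assms(6), of P j] by linarith
  qed
qed

lemma int_independent_cong:
  assumes "\<And>i. i \<in> I \<Longrightarrow> v i = w i"
  shows "int_independent I v \<longleftrightarrow> int_independent I w"
  unfolding int_independent_def using assms by simp

lemma int_independent_subset:
  assumes "int_independent I v" "J \<subseteq> I" "finite I"
  shows "int_independent J v"
  unfolding int_independent_def
proof (intro allI impI)
  fix q :: "'a \<Rightarrow> int"
  assume q: "\<forall>k. (\<Sum>i\<in>J. of_int (q i) * v i $ k) \<in> \<int>"
  have "(\<Sum>i\<in>I. of_int (if i \<in> J then q i else 0) * v i $ k) = (\<Sum>i\<in>J. of_int (q i) * v i $ k)" for k
    using assms(2,3) by (intro sum.mono_neutral_cong_right) auto
  with q have "\<forall>k. (\<Sum>i\<in>I. of_int (if i \<in> J then q i else 0) * v i $ k) \<in> \<int>"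
    by simp
  with assms(1)[unfolded int_independent_def, THEN spec, of "\<lambda>i. if i \<in> J then q i else 0"]
  have "\<forall>i\<in>I. (if i \<in> J then q i else 0) = 0"
    by (rule mp)
  then show "\<forall>i\<in>J. q i = 0"
    using assms(2) by (metis subsetD)
qed

text \<open>Normalized inner and outer counts are densities of sets below and above the same
  quasiperiodic set, so every inner value is at most every outer value, whatever the two orders. As
  their difference at equal order tends to 0, both converge to the supremum of the inner
  values.\<close>

lemma jordan_cell_volumes_convergent:
  fixes \<Lambda> :: "nat \<Rightarrow> real ^ 'n"
  assumes G: "G \<subseteq> unit_cube m" "jordan_measurable m G"
    and v: "int_independent (SIGMA k:{k}. {..<m}) (\<lambda>(k, i). \<Lambda> i)"
  obtains g where
    "(\<lambda>j. real (card (inner_cells m G (2 ^ j))) / real (2 ^ j) ^ m) \<longlonglongrightarrow> g"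
    "(\<lambda>j. real (card (outer_cells m G (2 ^ j))) / real (2 ^ j) ^ m) \<longlonglongrightarrow> g"
proof -
  define a where "a = (\<lambda>j. real (card (inner_cells m G (2 ^ j))) / real (2 ^ j) ^ m)"
  define b where "b = (\<lambda>j. real (card (outer_cells m G (2 ^ j))) / real (2 ^ j) ^ m)"
  have lim: "(box_density (cell_set m \<Lambda> (2 ^ j) S) \<longlongrightarrow> real (card S) / real (2 ^ j) ^ m) large_boxes"
    if "S \<subseteq> {..<m} \<rightarrow>\<^sub>E {..<2 ^ j}" for S j
    using box_density_Int_cell_sets[of "{k}" "2 ^ j" "\<lambda>_. S" "\<lambda>_. m" "\<lambda>_. \<Lambda>"] v that by simp
  have ab: "a i \<le> b j" for i j
  proof (rule tendsto_le[OF large_boxes_neq_bot])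
    show "(box_density (cell_set m \<Lambda> (2 ^ i) (inner_cells m G (2 ^ i))) \<longlongrightarrow> a i) large_boxes"
      unfolding a_def by (rule lim[OF inner_cells_subset])
    show "(box_density (cell_set m \<Lambda> (2 ^ j) (outer_cells m G (2 ^ j))) \<longlongrightarrow> b j) large_boxes"
      unfolding b_def by (rule lim[OF outer_cells_subset]) simp
    have "cell_set m \<Lambda> (2 ^ i) (inner_cells m G (2 ^ i)) \<subseteq> cell_set m \<Lambda> (2 ^ j) (outer_cells m G (2 ^ j))"
      by (rule order_trans[OF quasiperiodic_set_sandwich[OF G(1)]]) simp_all
    then show "eventually (\<lambda>P. box_density (cell_set m \<Lambda> (2 ^ i) (inner_cells m G (2 ^ i))) P
        \<le> box_density (cell_set m \<Lambda> (2 ^ j) (outer_cells m G (2 ^ j))) P) large_boxes"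
      using eventually_box_finite by (auto elim!: eventually_mono intro: box_density_mono)
  qed
  have "b j - a j = real (card (outer_cells m G (2 ^ j) - inner_cells m G (2 ^ j))) / real (2 ^ j) ^ m" for j
  proof -
    have le: "inner_cells m G (2 ^ j) \<subseteq> outer_cells m G (2 ^ j)"
      by (rule inner_cells_subset_outer_cells) simp
    have "finite (outer_cells m G (2 ^ j))"
      by (rule finite_subset[OF outer_cells_subset]) (simp_all add: finite_PiE)
    then show ?thesis
      using le unfolding a_def b_def
      by (simp add: card_Diff_subset[OF finite_subset[OF le]] of_nat_diff card_mono diff_divide_distrib)
  qed
  then have ba: "(\<lambda>j. b j - a j) \<longlonglongrightarrow> 0"
    using card_outer_minus_inner_tendsto[OF G] by simp
  define g where "g = (SUP i. a i)"
  have bdd: "bdd_above (range a)"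
    using ab[of _ 0] by (intro bdd_aboveI[of _ "b 0"]) auto
  have ag: "a j \<le> g" and gb: "g \<le> b j" for j
    unfolding g_def using ab by (auto intro: cSUP_upper[OF _ bdd] cSUP_least)
  have "(\<lambda>j. g - a j) \<longlonglongrightarrow> 0" "(\<lambda>j. b j - g) \<longlonglongrightarrow> 0"
    using ag gb by (auto intro!: tendsto_sandwich[OF _ _ tendsto_const ba])
  then have "a \<longlonglongrightarrow> g" "b \<longlonglongrightarrow> g"
    using tendsto_diff[OF tendsto_const[of g], of "\<lambda>j. g - a j" 0] LIM_zero_cancel[of b g] by auto
  then show thesis
    using that by (simp add: a_def b_def)
qed

lemma box_density_Int_quasiperiodic_sets:
  fixes \<Lambda> :: "'k \<Rightarrow> nat \<Rightarrow> real ^ 'n"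
  assumes K: "finite K"
    and G: "\<And>k. k \<in> K \<Longrightarrow> G k \<subseteq> unit_cube (m k)" "\<And>k. k \<in> K \<Longrightarrow> jordan_measurable (m k) (G k)"
    and v: "int_independent (SIGMA k:K. {..<m k}) (\<lambda>(k, i). \<Lambda> k i)"
  obtains g where "\<And>k. k \<in> K \<Longrightarrow> (box_density (quasiperiodic_set (m k) (G k) (\<Lambda> k)) \<longlongrightarrow> g k) large_boxes"
    "(box_density (\<Inter>k\<in>K. quasiperiodic_set (m k) (G k) (\<Lambda> k)) \<longlongrightarrow> (\<Prod>k\<in>K. g k)) large_boxes"
proof -
  define a where "a = (\<lambda>k j. real (card (inner_cells (m k) (G k) (2 ^ j))) / real (2 ^ j) ^ m k)"
  define b where "b = (\<lambda>k j. real (card (outer_cells (m k) (G k) (2 ^ j))) / real (2 ^ j) ^ m k)"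
  have fin: "finite (SIGMA k:K. {..<m k})"
    using K by simp
  have vJ: "int_independent (SIGMA k:J. {..<m k}) (\<lambda>(k, i). \<Lambda> k i)" if "J \<subseteq> K" for J
    by (rule int_independent_subset[OF v _ fin]) (use that in auto)
  have "\<exists>g. a k \<longlonglongrightarrow> g \<and> b k \<longlonglongrightarrow> g" if k: "k \<in> K" for k
  proof -
    have "(SIGMA k':{k}. {..<m k'}) = {k} \<times> {..<m k}"
      by auto
    then have "int_independent ({k} \<times> {..<m k}) (\<lambda>(k, i). \<Lambda> k i)"
      using vJ[of "{k}"] k by simp
    then have "int_independent (SIGMA k':{k}. {..<m k}) (\<lambda>(k', i). \<Lambda> k i)"
      by (rule int_independent_cong[THEN iffD1, rotated]) auto
    from jordan_cell_volumes_convergent[OF G[OF k] this] show ?thesis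
      unfolding a_def b_def by blast
  qed
  then obtain g where g: "\<And>k. k \<in> K \<Longrightarrow> a k \<longlonglongrightarrow> g k" "\<And>k. k \<in> K \<Longrightarrow> b k \<longlonglongrightarrow> g k"
    by metis
  \<comment> \<open>Stated for all \<open>J\<close> inside \<open>K\<close>: singletons give the
    individual densities and \<open>K\<close> itself the density of the intersection, with the same
    numbers \<open>g k\<close>.\<close>
  have main: "(box_density (\<Inter>k\<in>J. quasiperiodic_set (m k) (G k) (\<Lambda> k)) \<longlongrightarrow> (\<Prod>k\<in>J. g k)) large_boxes"
    if J: "J \<subseteq> K" for J
  proof (rule box_density_tendsto_sandwich)
    have finJ: "finite J" using K J by (rule finite_subset[rotated])
    show "(\<lambda>j. \<Prod>k\<in>J. a k j) \<longlonglongrightarrow> (\<Prod>k\<in>J. g k)" "(\<lambda>j. \<Prod>k\<in>J. b k j) \<longlonglongrightarrow> (\<Prod>k\<in>J. g k)"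
      using J g by (auto intro!: tendsto_prod)
    show "(box_density (\<Inter>k\<in>J. cell_set (m k) (\<Lambda> k) (2 ^ j) (inner_cells (m k) (G k) (2 ^ j)))
        \<longlongrightarrow> (\<Prod>k\<in>J. a k j)) large_boxes" for j
      unfolding a_def using finJ vJ[OF J] by (intro box_density_Int_cell_sets inner_cells_subset) auto
    show "(box_density (\<Inter>k\<in>J. cell_set (m k) (\<Lambda> k) (2 ^ j) (outer_cells (m k) (G k) (2 ^ j)))
        \<longlongrightarrow> (\<Prod>k\<in>J. b k j)) large_boxes" for j
      unfolding b_def using finJ vJ[OF J] by (intro box_density_Int_cell_sets outer_cells_subset) auto
    show "(\<Inter>k\<in>J. cell_set (m k) (\<Lambda> k) (2 ^ j) (inner_cells (m k) (G k) (2 ^ j)))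
        \<subseteq> (\<Inter>k\<in>J. quasiperiodic_set (m k) (G k) (\<Lambda> k))" for j
      using J G(1) by (intro INT_anti_mono quasiperiodic_set_sandwich) auto
    show "(\<Inter>k\<in>J. quasiperiodic_set (m k) (G k) (\<Lambda> k))
        \<subseteq> (\<Inter>k\<in>J. cell_set (m k) (\<Lambda> k) (2 ^ j) (outer_cells (m k) (G k) (2 ^ j)))" for j
      using J G(1) by (intro INT_anti_mono quasiperiodic_set_sandwich) auto
  qed
  show thesis
  proof (rule that)
    show "(box_density (quasiperiodic_set (m k) (G k) (\<Lambda> k)) \<longlongrightarrow> g k) large_boxes" if "k \<in> K" for k
      using main[of "{k}"] that by simp
  qed (rule main[OF order_refl])
qed

section \<open>From nonresonance to integer independence of rows\<close>

lemma nonresonant_fin_imp_int_independent: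
  fixes \<Lambda> :: "nat \<Rightarrow> real ^ 'n"
  assumes "nonresonant_fin m \<Lambda>"
  shows "int_independent {..<m} \<Lambda>"
  unfolding int_independent_def
proof (intro allI impI)
  fix q :: "nat \<Rightarrow> int"
  assume "\<forall>k. (\<Sum>i<m. of_int (q i) * \<Lambda> i $ k) \<in> \<int>"
  then have "\<forall>k. \<exists>z. (\<Sum>i<m. of_int (q i) * \<Lambda> i $ k) = of_int z"
    by (auto elim: Ints_cases)
  then obtain z :: "'n \<Rightarrow> int" where z: "\<And>k. (\<Sum>i<m. of_int (q i) * \<Lambda> i $ k) = of_int (z k)"
    by metis
  interpret rs: vector_space rat_scale
    by (rule vector_space_rat_scale)
  define T :: "('n + nat) set" where "T = UNIV <+> {..<m}"
  define s where "s = stacked_row \<Lambda>"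
  \<comment> \<open>The integer vector \<open>z\<close> is cancelled by giving the identity rows the
    coefficients \<open>- z k\<close>; the result is a rational relation among the stacked
    rows.\<close>
  define w :: "'n + nat \<Rightarrow> rat" where "w = case_sum (\<lambda>k. - of_int (z k)) (\<lambda>i. of_int (q i))"
  have inj: "inj_on s T" and indep: "\<not> rs.dependent (s ` T)"
    using assms by (auto simp: nonresonant_fin_def s_def T_def)
  have fin: "finite T" by (simp add: T_def)
  have "(\<Sum>p\<in>T. rat_scale (w p) (s p)) = 0"
  proof (rule vec_eq_iff[THEN iffD2], rule allI)
    fix k
    have "(\<Sum>p\<in>T. rat_scale (w p) (s p)) $ k =
        (\<Sum>l\<in>UNIV. - of_int (z l) * row l (mat 1 :: real ^ 'n ^ 'n) $ k) + (\<Sum>i<m. of_int (q i) * \<Lambda> i $ k)"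
      unfolding T_def
      by (subst sum.Plus) (simp_all add: w_def s_def stacked_row_def rat_scale_def of_rat_minus)
    also have "(\<Sum>l\<in>UNIV. - of_int (z l) * row l (mat 1 :: real ^ 'n ^ 'n) $ k)
        = (\<Sum>l\<in>UNIV. if l = k then - of_int (z l) else 0)"
      by (intro sum.cong) (auto simp: row_def mat_def)
    also have "\<dots> = - of_int (z k)" by simp
    finally show "(\<Sum>p\<in>T. rat_scale (w p) (s p)) $ k = 0 $ k"
      using z by simp
  qed
  \<comment> \<open>Linear independence concerns the set of rows; injectivity of \<open>s\<close>
    turns coefficients indexed by \<open>T\<close> into coefficients attached to rows.\<close>
  then have "(\<Sum>y\<in>s ` T. rat_scale (w (the_inv_into T s y)) y) = 0"
    by (simp add: sum.reindex[OF inj] the_inv_into_f_f[OF inj])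
  with indep fin have "\<forall>y\<in>s ` T. w (the_inv_into T s y) = 0"
    using rs.dependent_finite[of "s ` T"] by (auto simp del: ball_simps)
  then have w0: "\<forall>p\<in>T. w p = 0"
    by (simp add: the_inv_into_f_f[OF inj])
  show "\<forall>i\<in>{..<m}. q i = 0"
  proof
    fix i assume "i \<in> {..<m}"
    then have "Inr i \<in> T" by (auto simp: T_def)
    with w0 have "w (Inr i) = 0" by blast
    then show "q i = 0" by (simp add: w_def)
  qed
qed

text \<open>Nonresonance speaks of rows numbered by a nonempty initial segment of the naturals. An
  enumeration of \<open>I\<close> carries it over to any finite index type, and an empty family is
  trivially independent.\<close>

lemma nonresonant_imp_int_independent:
  fixes L :: "int \<Rightarrow> real ^ 'n"
  assumes L: "nonresonant L" and I: "finite I" and s: "inj_on s I"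
  shows "int_independent I (\<lambda>i. L (s i))"
proof (cases "I = {}")
  case False
  obtain h where h: "bij_betw h {..<card I} I"
    using ex_bij_betw_nat_finite[OF I] by (auto simp: atLeast0LessThan)
  have "bij_betw (s \<circ> h) {..<card I} (s ` I)"
    by (rule bij_betw_trans[OF h inj_on_imp_bij_betw[OF s]])
  then have "submatrix L (s ` I) {..<card I} (\<lambda>i. L (s (h i)))"
    unfolding submatrix_def by (intro exI[of _ "s \<circ> h"]) simp
  moreover have "card I \<ge> 1"
    using False I by (simp add: Suc_le_eq card_gt_0_iff)
  ultimately have "nonresonant_fin (card I) (\<lambda>i. L (s (h i)))"
    using L unfolding nonresonant_def by blast
  then have ind: "int_independent {..<card I} (\<lambda>i. L (s (h i)))"
    by (rule nonresonant_fin_imp_int_independent)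
  show ?thesis
    unfolding int_independent_def
  proof (intro allI impI)
    fix q :: "'a \<Rightarrow> int"
    assume q: "\<forall>k. (\<Sum>i\<in>I. of_int (q i) * L (s i) $ k) \<in> \<int>"
    have "(\<Sum>i\<in>I. of_int (q i) * L (s i) $ k) = (\<Sum>i<card I. of_int (q (h i)) * L (s (h i)) $ k)" for k
      by (rule sum.reindex_bij_betw[OF h, symmetric])
    with q have "\<forall>i\<in>{..<card I}. q (h i) = 0"
      using ind[unfolded int_independent_def, rule_format, of "\<lambda>i. q (h i)"] by auto
    then show "\<forall>i\<in>I. q i = 0"
      using bij_betw_imp_surj_on[OF h] by force
  qed
qed (simp add: int_independent_def)

lemma independent_quasiperiodic:
  fixes L :: "int \<Rightarrow> real ^ 'n" and A :: "nat \<Rightarrow> (int ^ 'n) set"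
  assumes L: "nonresonant L"
    and M: "\<forall>k\<in>{1..N}. submatrix L (R k) UNIV (M k)"
    and R: "disjoint_family_on R {1..N}"
    and A: "\<forall>k\<in>{1..N}. A k \<in> quasiperiodic (M k)"
  shows "(\<forall>k\<in>{1..N}. freq_measurable (A k)) \<and> freq_measurable (\<Inter>k\<in>{1..N}. A k) \<and>
    freq (\<Inter>k\<in>{1..N}. A k) = (\<Prod>k\<in>{1..N}. freq (A k))"
proof -
  let ?Q = "\<lambda>k (m, \<Lambda>, G, s). A k = quasiperiodic_set m G \<Lambda> \<and> G \<subseteq> unit_cube m \<and> jordan_measurable m G
      \<and> inj_on s {..<m} \<and> s ` {..<m} \<subseteq> R k \<and> (\<forall>i<m. \<Lambda> i = L (s i))"
  have "\<exists>d. ?Q k d" if k: "k \<in> {1..N}" for k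
  proof -
    obtain m \<Lambda> R' G where *: "submatrix (M k) R' {..<m} \<Lambda>" "A k = quasiperiodic_set m G \<Lambda>"
      "G \<subseteq> unit_cube m" "jordan_measurable m G"
      using A k unfolding quasiperiodic_def quasiperiodic_fin_def by blast
    obtain r where r: "bij_betw r {..<m} R'" "\<forall>i\<in>{..<m}. \<Lambda> i = M k (r i)"
      using *(1) unfolding submatrix_def by blast
    obtain t where t: "bij_betw t UNIV (R k)" "\<forall>i\<in>UNIV. M k i = L (t i)"
      using M k unfolding submatrix_def by blast
    \<comment> \<open>Composing the two selections of rows traces the finite matrix back to rows of
      \<open>L\<close> with distinct indices in \<open>R k\<close>.\<close>
    have "inj_on (t \<circ> r) {..<m}"
      using r(1) t(1) by (intro comp_inj_on) (auto simp: bij_betw_def intro: inj_on_subset)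
    moreover have "(t \<circ> r) ` {..<m} \<subseteq> R k"
      using t(1) by (auto simp: bij_betw_def)
    ultimately have "?Q k (m, \<Lambda>, G, t \<circ> r)"
      using * r t by simp
    then show ?thesis by (rule exI)
  qed
  then have "\<forall>k\<in>{1..N}. \<exists>d. ?Q k d" by (rule ballI)
  then obtain d where d: "\<forall>k\<in>{1..N}. ?Q k (d k)"
    by (rule bchoice[THEN exE])
  define m where "m = (\<lambda>k. fst (d k))"
  define \<Lambda> where "\<Lambda> = (\<lambda>k. fst (snd (d k)))"
  define G where "G = (\<lambda>k. fst (snd (snd (d k))))"
  define s where "s = (\<lambda>k. snd (snd (snd (d k))))"
  have Ak: "A k = quasiperiodic_set (m k) (G k) (\<Lambda> k)"
    and Gk: "G k \<subseteq> unit_cube (m k)" "jordan_measurable (m k) (G k)"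
    and sk: "inj_on (s k) {..<m k}" "s k ` {..<m k} \<subseteq> R k" "\<And>i. i < m k \<Longrightarrow> \<Lambda> k i = L (s k i)"
    if "k \<in> {1..N}" for k
    using bspec[OF d that] by (auto simp: m_def \<Lambda>_def G_def s_def split_beta)
  define I where "I = (SIGMA k:{1..N}. {..<m k})"
  \<comment> \<open>Nonoverlap enters here: disjointness of the sets \<open>R k\<close> separates
    rows of different groups, and injectivity of \<open>s k\<close> separates rows within a
    group.\<close>
  have "inj_on (\<lambda>(k, i). s k i) I"
  proof (rule inj_onI, clarify)
    fix k i k' i' assume p: "(k, i) \<in> I" "(k', i') \<in> I" and eq: "s k i = s k' i'"
    then have k: "k \<in> {1..N}" "k' \<in> {1..N}" "i < m k" "i' < m k'"
      by (auto simp: I_def)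
    then have "s k i \<in> R k" "s k' i' \<in> R k'"
      using sk(2) by blast+
    then have "k = k'"
      using R k eq unfolding disjoint_family_on_def by fastforce
    then show "k = k' \<and> i = i'"
      using eq k inj_onD[OF sk(1)[OF k(1)]] by auto
  qed
  then have "int_independent I (\<lambda>p. L ((\<lambda>(k, i). s k i) p))"
    by (intro nonresonant_imp_int_independent L) (auto simp: I_def)
  then have "int_independent I (\<lambda>(k, i). \<Lambda> k i)"
    by (rule int_independent_cong[THEN iffD1, rotated]) (auto simp: I_def sk(3))
  then obtain g where g: "\<And>k. k \<in> {1..N} \<Longrightarrow> (box_density (quasiperiodic_set (m k) (G k) (\<Lambda> k)) \<longlongrightarrow> g k) large_boxes"
    "(box_density (\<Inter>k\<in>{1..N}. quasiperiodic_set (m k) (G k) (\<Lambda> k)) \<longlongrightarrow> (\<Prod>k\<in>{1..N}. g k)) large_boxes"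
    unfolding I_def using box_density_Int_quasiperiodic_sets[of "{1..N}" G m \<Lambda>] Gk by blast
  have gA: "(box_density (A k) \<longlongrightarrow> g k) large_boxes" if "k \<in> {1..N}" for k
    using g(1) that Ak by simp
  have "(box_density (\<Inter>k\<in>{1..N}. A k) \<longlongrightarrow> (\<Prod>k\<in>{1..N}. g k)) large_boxes"
    using g(2) Ak by simp
  moreover have "(\<Prod>k\<in>{1..N}. g k) = (\<Prod>k\<in>{1..N}. freq (A k))"
    by (rule prod.cong[OF refl]) (simp add: freq_eqI(2)[OF gA])
  ultimately have lim: "(box_density (\<Inter>k\<in>{1..N}. A k) \<longlongrightarrow> (\<Prod>k\<in>{1..N}. freq (A k))) large_boxes"
    by simp
  show ?thesis
    using freq_eqI(1)[OF gA] freq_eqI[OF lim] by blast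
qed

theorem theorem4:
  fixes L :: "int \<Rightarrow> real ^ 'n"
  assumes "nonresonant L"
  shows "(\<forall>A\<in>quasiperiodic L. freq_measurable A) \<and>
    (\<forall>(N::nat) (M :: nat \<Rightarrow> int \<Rightarrow> real ^ 'n) (R :: nat \<Rightarrow> int set) (A :: nat \<Rightarrow> (int ^ 'n) set).
       N \<ge> 1 \<longrightarrow>
       (\<forall>k\<in>{1..N}. submatrix L (R k) UNIV (M k)) \<longrightarrow>
       disjoint_family_on R {1..N} \<longrightarrow>
       (\<forall>k\<in>{1..N}. A k \<in> quasiperiodic (M k)) \<longrightarrow>
       (\<forall>k\<in>{1..N}. freq_measurable (A k)) \<and>
       freq_measurable (\<Inter>k\<in>{1..N}. A k) \<and>
       freq (\<Inter>k\<in>{1..N}. A k) = (\<Prod>k\<in>{1..N}. freq (A k)))"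
proof (rule conjI[OF ballI]; (intro allI impI)?)
  fix A assume A: "A \<in> quasiperiodic L"
  \<comment> \<open>Part (a) is the case of one group, with \<open>L\<close> as a submatrix of
    itself.\<close>
  have "submatrix L UNIV UNIV L"
    unfolding submatrix_def by (intro exI[of _ id]) simp
  then show "freq_measurable A"
    using independent_quasiperiodic[OF assms, of 1 "\<lambda>_. UNIV" "\<lambda>_. L" "\<lambda>_. A"] A
    by (simp add: disjoint_family_on_def)
qed (rule independent_quasiperiodic[OF assms])

end
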